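(* For $f\in\mathcal{A}_c(\mathbb{R})$ let $\Omega_f(s)=\int_{-\infty}^\infty v_s f$ ($s\in\mathbb{R}$). (a) Let $\mathcal{C}_c(\mathbb{R})=\{\Omega_f\mid f\in\mathcal{A}_c(\mathbb{R})\}$ with norm $\|\Omega_f\|^{(1)}=\|f\|$. Then $\mathcal{C}_c(\mathbb{R})$ is a Banach space isometrically isomorphic to $\mathcal{A}_c(\mathbb{R})$. (b) Let $\mathcal{D}_c(\mathbb{R})=\{\Omega_f''\mid f\in\mathcal{A}_c(\mathbb{R})\}$ (second distributional derivatives) with norm $\|\Omega_f''\|^{(2)}=\|f\|$. Then $\mathcal{D}_c(\mathbb{R})$ is a Banach space isometrically isomorphic to $\mathcal{A}_c(\mathbb{R})$. (c) The four Banach spaces $\mathcal{A}_c(\mathbb{R})$ (with the Alexiewicz norm), $\mathcal{B}_c(\mathbb{R})$ (with the uniform norm), $\mathcal{C}_c(\mathbb{R})$ and $\mathcal{D}_c(\mathbb{R})$ are isometrically isomorphic.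
   Context: A function $F:[-\infty,\infty]\to\mathbb{C}$ is continuous on the extended real line if it is continuous on $\mathbb{R}$ and the limits $F(\pm\infty)$ exist. $\mathcal{B}_c(\mathbb{R})$ is the set of such $F$ with $F(-\infty)=0$, normed by $\|F\|_\infty=\sup|F|$. $\mathcal{A}_c(\mathbb{R})$ is the set of tempered distributions $f=F'$ (distributional derivative) with $F\in\mathcal{B}_c(\mathbb{R})$ (the primitive, unique); the Alexiewicz norm is $\|f\|=\|F\|_\infty$. For $g$ of bounded variation on $\mathbb{R}$, $\int_{-\infty}^\infty fg=F(\infty)g(\infty)-\int_{-\infty}^\infty F\,dg$. For $s,t\in\mathbb{R}$, $v_s(t)=(1-ist-e^{-ist})/t^2$ ($t\ne0$), $v_s(0)=s^2/2$; $v_s$ is of bounded variation in $t$. *)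

theory Defs
  imports "HOL-Analysis.Analysis"
begin

definition ext_cont :: "(real \<Rightarrow> complex) \<Rightarrow> bool" where
  "ext_cont F \<longleftrightarrow> continuous_on UNIV F \<and>
     (\<exists>L. (F \<longlongrightarrow> L) at_top) \<and> (\<exists>L. (F \<longlongrightarrow> L) at_bot)"

definition Bc :: "(real \<Rightarrow> complex) set" where
  "Bc = {F. ext_cont F \<and> (F \<longlongrightarrow> 0) at_bot}"

definition supnorm :: "(real \<Rightarrow> complex) \<Rightarrow> real" where
  "supnorm F = (SUP x. cmod (F x))"

definition smooth_fn :: "(real \<Rightarrow> real) \<Rightarrow> bool" where
  "smooth_fn \<phi> \<longleftrightarrow> (\<forall>k x. ((deriv ^^ k) \<phi>) differentiable (at x))"

definition test_fn :: "(real \<Rightarrow> real) \<Rightarrow> bool" where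
  "test_fn \<phi> \<longleftrightarrow> smooth_fn \<phi> \<and> bounded {x. \<phi> x \<noteq> 0}"

type_synonym distr = "(real \<Rightarrow> real) \<Rightarrow> complex"

text \<open>A distribution is identified with its restriction to test functions.\<close>
definition distr_of :: "distr \<Rightarrow> distr" where
  "distr_of T = (\<lambda>\<phi>. if test_fn \<phi> then T \<phi> else 0)"

definition dist_fun :: "(real \<Rightarrow> complex) \<Rightarrow> distr" where
  "dist_fun G = (\<lambda>\<phi>. integral UNIV (\<lambda>x. complex_of_real (\<phi> x) * G x))"

definition dderiv :: "distr \<Rightarrow> distr" where
  "dderiv T = (\<lambda>\<phi>. - T (deriv \<phi>))"

definition Ac :: "distr set" where
  "Ac = {distr_of (dderiv (dist_fun F)) | F. F \<in> Bc}"

definition prim :: "distr \<Rightarrow> (real \<Rightarrow> complex)" where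
  "prim f = (THE F. F \<in> Bc \<and> f = distr_of (dderiv (dist_fun F)))"

definition alex :: "distr \<Rightarrow> real" where
  "alex f = supnorm (prim f)"

text \<open>Pairing with a function g of bounded variation; for the (smooth) g used here
  the Stieltjes integral against dg is the integral against g'.\<close>
definition pairing :: "distr \<Rightarrow> (real \<Rightarrow> complex) \<Rightarrow> complex" where
  "pairing f g = Lim at_top (prim f) * Lim at_top g
     - integral UNIV (\<lambda>t. prim f t * vector_derivative g (at t))"

definition vfun :: "real \<Rightarrow> real \<Rightarrow> complex" where
  "vfun s t = (if t = 0 then complex_of_real (s\<^sup>2 / 2)
     else (1 - \<i> * complex_of_real (s * t) - exp (- \<i> * complex_of_real (s * t)))
           / complex_of_real (t\<^sup>2))"

definition Omega :: "distr \<Rightarrow> real \<Rightarrow> complex" where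
  "Omega f = (\<lambda>s. pairing f (vfun s))"

definition Omega2 :: "distr \<Rightarrow> distr" where
  "Omega2 f = distr_of (dderiv (dderiv (dist_fun (Omega f))))"

definition Cc :: "(real \<Rightarrow> complex) set" where
  "Cc = Omega ` Ac"

definition norm1 :: "(real \<Rightarrow> complex) \<Rightarrow> real" where
  "norm1 g = alex (THE f. f \<in> Ac \<and> Omega f = g)"

definition Dc :: "distr set" where
  "Dc = Omega2 ` Ac"

definition norm2 :: "distr \<Rightarrow> real" where
  "norm2 g = alex (THE f. f \<in> Ac \<and> Omega2 f = g)"

definition cspace :: "('a \<Rightarrow> complex) set \<Rightarrow> bool" where
  "cspace S \<longleftrightarrow> (\<lambda>x. 0) \<in> S \<and>
     (\<forall>f\<in>S. \<forall>g\<in>S. (\<lambda>x. f x + g x) \<in> S) \<and>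
     (\<forall>c. \<forall>f\<in>S. (\<lambda>x. c * f x) \<in> S)"

definition normed_on :: "('a \<Rightarrow> complex) set \<Rightarrow> (('a \<Rightarrow> complex) \<Rightarrow> real) \<Rightarrow> bool" where
  "normed_on S N \<longleftrightarrow>
     (\<forall>f\<in>S. 0 \<le> N f \<and> (N f = 0 \<longleftrightarrow> f = (\<lambda>x. 0))) \<and>
     (\<forall>c. \<forall>f\<in>S. N (\<lambda>x. c * f x) = cmod c * N f) \<and>
     (\<forall>f\<in>S. \<forall>g\<in>S. N (\<lambda>x. f x + g x) \<le> N f + N g)"

definition complete_on :: "('a \<Rightarrow> complex) set \<Rightarrow> (('a \<Rightarrow> complex) \<Rightarrow> real) \<Rightarrow> bool" where
  "complete_on S N \<longleftrightarrow>
     (\<forall>u. (\<forall>n. u n \<in> S) \<longrightarrow>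
        (\<forall>e>0. \<exists>M. \<forall>m\<ge>M. \<forall>n\<ge>M. N (\<lambda>x. u m x - u n x) < e) \<longrightarrow>
        (\<exists>l\<in>S. (\<lambda>n. N (\<lambda>x. u n x - l x)) \<longlonglongrightarrow> 0))"

definition banach_on :: "('a \<Rightarrow> complex) set \<Rightarrow> (('a \<Rightarrow> complex) \<Rightarrow> real) \<Rightarrow> bool" where
  "banach_on S N \<longleftrightarrow> cspace S \<and> normed_on S N \<and> complete_on S N"

definition isometric_iso ::
  "('a \<Rightarrow> complex) set \<Rightarrow> (('a \<Rightarrow> complex) \<Rightarrow> real) \<Rightarrow>
   ('b \<Rightarrow> complex) set \<Rightarrow> (('b \<Rightarrow> complex) \<Rightarrow> real) \<Rightarrow> bool" where
  "isometric_iso S N T M \<longleftrightarrow> (\<exists>\<Phi>. bij_betw \<Phi> S T \<and>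
     (\<forall>f\<in>S. \<forall>g\<in>S. \<Phi> (\<lambda>x. f x + g x) = (\<lambda>y. \<Phi> f y + \<Phi> g y)) \<and>
     (\<forall>c. \<forall>f\<in>S. \<Phi> (\<lambda>x. c * f x) = (\<lambda>y. c * \<Phi> f y)) \<and>
     (\<forall>f\<in>S. M (\<Phi> f) = N f))"

end

theory Submission
  imports Defs "HOL-Computational_Algebra.Polynomial" "HOL-Real_Asymp.Real_Asymp"
    "HOL-Probability.Sinc_Integral"
begin

text \<open>
  All four spaces are images of \<open>Bc\<close> under injective linear maps that carry the uniform norm to the
  given norm, so everything reduces to completeness of \<open>Bc\<close> and to injectivity of \<open>F \<mapsto> F'\<close> and of
  \<open>F \<mapsto> \<Omega>''\<close>; the latter implies injectivity of \<open>F \<mapsto> \<Omega>\<close>.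

  Testing \<open>\<Omega>''\<close> against \<open>\<phi>\<close> and integrating by parts in \<open>s\<close>, where the second \<open>s\<close>-derivative of \<open>v\<^sub>s(t)\<close>
  is \<open>exp (- i s t)\<close>, gives minus the integral of \<open>F\<close> against the derivative of the Fourier
  transform of \<open>\<phi>\<close>. Hence both kernels consist of \<open>F\<close> orthogonal to the derivatives of all translates
  and dilates of some kernel \<open>k\<close> with \<open>k, k' = O(1/(1 + x\<^sup>2))\<close> and nonzero integral: a bump function
  in the first case, the transform of a test function in the second. For such an \<open>F\<close> the
  correlation of \<open>F\<close> with each dilate of \<open>k\<close> is constant, hence \<open>0\<close> because \<open>F(-\<infinity>) = 0\<close>, and
  shrinking the dilates gives \<open>F = 0\<close>.
\<close>

section \<open>Isometric isomorphisms and completeness of the space of primitives\<close>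

text \<open>Transport of structure along an injective linear map: a Cauchy sequence in the image is
  pulled back term by term, which is possible because \<open>M\<close> of a difference equals
  \<open>N\<close> of the difference of preimages. \<open>M\<close> is constrained only on the
  image, so the norms given by definite descriptions have to be computed only there.\<close>

lemma banach_on_isometric_image:
  assumes S: "banach_on S N" and inj: "inj_on \<Phi> S"
    and add: "\<And>f g. f \<in> S \<Longrightarrow> g \<in> S \<Longrightarrow> \<Phi> (\<lambda>x. f x + g x) = (\<lambda>y. \<Phi> f y + \<Phi> g y)"
    and scale: "\<And>c f. f \<in> S \<Longrightarrow> \<Phi> (\<lambda>x. c * f x) = (\<lambda>y. c * \<Phi> f y)"
    and norm: "\<And>f. f \<in> S \<Longrightarrow> M (\<Phi> f) = N f"
  shows "banach_on (\<Phi> ` S) M" and "isometric_iso S N (\<Phi> ` S) M"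
proof -
  have cS: "cspace S" and nS: "normed_on S N" and comp: "complete_on S N"
    using S by (auto simp: banach_on_def)
  have z: "(\<lambda>x. 0) \<in> S" and a: "\<And>f g. f \<in> S \<Longrightarrow> g \<in> S \<Longrightarrow> (\<lambda>x. f x + g x) \<in> S"
    and s: "\<And>c f. f \<in> S \<Longrightarrow> (\<lambda>x. c * f x) \<in> S"
    using cS by (auto simp: cspace_def)
  have \<Phi>0: "\<Phi> (\<lambda>x. 0) = (\<lambda>y. 0)"
    using scale[OF z, of 0] by simp
  have d: "(\<lambda>x. f x - g x) \<in> S" if "f \<in> S" "g \<in> S" for f g
    using a[OF that(1) s[OF that(2), of "-1"]] by simp
  have \<Phi>d: "\<Phi> (\<lambda>x. f x - g x) = (\<lambda>y. \<Phi> f y - \<Phi> g y)" if "f \<in> S" "g \<in> S" for f g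
    using add[OF that(1) s[OF that(2), of "-1"]] scale[OF that(2), of "-1"] by simp
  have "cspace (\<Phi> ` S)"
    unfolding cspace_def
  proof (intro conjI ballI allI)
    show "(\<lambda>x. 0) \<in> \<Phi> ` S" using \<Phi>0 z by (metis imageI)
    show "(\<lambda>x. f x + g x) \<in> \<Phi> ` S" if "f \<in> \<Phi> ` S" "g \<in> \<Phi> ` S" for f g
      using that by (auto simp flip: add intro!: imageI a)
    show "(\<lambda>x. c * f x) \<in> \<Phi> ` S" if "f \<in> \<Phi> ` S" for f c
      using that by (auto simp flip: scale intro!: imageI s)
  qed
  moreover have "normed_on (\<Phi> ` S) M"
    unfolding normed_on_def
  proof (intro conjI ballI allI)
    fix f assume "f \<in> \<Phi> ` S"
    then obtain f' where f: "f' \<in> S" "f = \<Phi> f'" by auto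
    show "0 \<le> M f" using f nS by (auto simp: norm normed_on_def)
    have "f = (\<lambda>x. 0) \<longleftrightarrow> f' = (\<lambda>x. 0)"
      using inj f z \<Phi>0 by (metis inj_onD)
    then show "M f = 0 \<longleftrightarrow> f = (\<lambda>x. 0)" using f nS by (auto simp: norm normed_on_def)
    show "M (\<lambda>x. c * f x) = cmod c * M f" for c
      using f nS by (auto simp: norm normed_on_def s simp flip: scale)
    fix g assume "g \<in> \<Phi> ` S"
    then show "M (\<lambda>x. f x + g x) \<le> M f + M g"
      using f nS by (auto simp: norm normed_on_def a simp flip: add)
  qed
  moreover have "complete_on (\<Phi> ` S) M"
    unfolding complete_on_def
  proof (intro allI impI)
    fix u :: "nat \<Rightarrow> _"
    assume u: "\<forall>n. u n \<in> \<Phi> ` S"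
      and C: "\<forall>e>0. \<exists>K. \<forall>m\<ge>K. \<forall>n\<ge>K. M (\<lambda>x. u m x - u n x) < e"
    have "\<forall>n. \<exists>f. f \<in> S \<and> u n = \<Phi> f" using u by blast
    then obtain w where w: "\<And>n. w n \<in> S" "\<And>n. u n = \<Phi> (w n)" by metis
    have eq: "M (\<lambda>y. \<Phi> f y - \<Phi> g y) = N (\<lambda>x. f x - g x)" if "f \<in> S" "g \<in> S" for f g
      unfolding \<Phi>d[OF that, symmetric] by (rule norm[OF d[OF that]])
    have eqw: "M (\<lambda>x. u m x - u n x) = N (\<lambda>x. w m x - w n x)" for m n
      unfolding w(2)[of m] w(2)[of n] by (rule eq[OF w(1)[of m] w(1)[of n]])
    have "\<forall>e>0. \<exists>K. \<forall>m\<ge>K. \<forall>n\<ge>K. N (\<lambda>x. w m x - w n x) < e"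
      using C by (simp only: eqw)
    then obtain l where l: "l \<in> S" "(\<lambda>n. N (\<lambda>x. w n x - l x)) \<longlonglongrightarrow> 0"
      using comp[unfolded complete_on_def, rule_format, of w] w(1) by blast
    have "M (\<lambda>x. u n x - \<Phi> l x) = N (\<lambda>x. w n x - l x)" for n
      unfolding w(2)[of n] by (rule eq[OF w(1)[of n] l(1)])
    with l(2) have "(\<lambda>n. M (\<lambda>x. u n x - \<Phi> l x)) \<longlonglongrightarrow> 0" by (simp only:)
    with l(1) show "\<exists>l\<in>\<Phi> ` S. (\<lambda>n. M (\<lambda>x. u n x - l x)) \<longlonglongrightarrow> 0" by blast
  qed
  ultimately show "banach_on (\<Phi> ` S) M" by (simp add: banach_on_def)
  show "isometric_iso S N (\<Phi> ` S) M"
    unfolding isometric_iso_def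
    using inj add scale norm by (intro exI[of _ \<Phi>]) (auto simp: inj_on_imp_bij_betw)
qed

text \<open>Linearity of the inverse is read off by applying it to the image of a sum or multiple of
  preimages; this requires \<open>S\<close> to be closed under both operations.\<close>

lemma isometric_iso_sym:
  assumes cS: "cspace S" and iso: "isometric_iso S N T M"
  shows "isometric_iso T M S N"
proof -
  obtain \<Phi> where bij: "bij_betw \<Phi> S T"
    and add: "\<And>f g. f \<in> S \<Longrightarrow> g \<in> S \<Longrightarrow> \<Phi> (\<lambda>x. f x + g x) = (\<lambda>y. \<Phi> f y + \<Phi> g y)"
    and scale: "\<And>c f. f \<in> S \<Longrightarrow> \<Phi> (\<lambda>x. c * f x) = (\<lambda>y. c * \<Phi> f y)"
    and norm: "\<And>f. f \<in> S \<Longrightarrow> M (\<Phi> f) = N f"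
    using iso unfolding isometric_iso_def by blast
  define \<Psi> where "\<Psi> = inv_into S \<Phi>"
  have \<Psi>: "\<Psi> g \<in> S" "\<Phi> (\<Psi> g) = g" if "g \<in> T" for g
    using that bij unfolding \<Psi>_def by (auto simp: bij_betw_def inv_into_into f_inv_into_f)
  have \<Psi>': "\<Psi> (\<Phi> f) = f" if "f \<in> S" for f
    using that bij unfolding \<Psi>_def by (simp add: bij_betw_inv_into_left)
  have a: "\<And>f g. f \<in> S \<Longrightarrow> g \<in> S \<Longrightarrow> (\<lambda>x. f x + g x) \<in> S"
    and s: "\<And>c f. f \<in> S \<Longrightarrow> (\<lambda>x. c * f x) \<in> S"
    using cS by (auto simp: cspace_def)
  show ?thesis
    unfolding isometric_iso_def
  proof (intro exI[of _ \<Psi>] conjI ballI allI)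
    show "bij_betw \<Psi> T S" unfolding \<Psi>_def by (rule bij_betw_inv_into[OF bij])
    show "\<Psi> (\<lambda>x. f x + g x) = (\<lambda>y. \<Psi> f y + \<Psi> g y)" if "f \<in> T" "g \<in> T" for f g
      using \<Psi>'[OF a[OF \<Psi>(1)[OF that(1)] \<Psi>(1)[OF that(2)]]] that by (simp add: add \<Psi>)
    show "\<Psi> (\<lambda>x. c * f x) = (\<lambda>y. c * \<Psi> f y)" if "f \<in> T" for f c
      using \<Psi>'[OF s[OF \<Psi>(1)[OF that]]] that by (simp add: scale \<Psi>)
    show "N (\<Psi> f) = M f" if "f \<in> T" for f
      using norm[OF \<Psi>(1)[OF that]] that by (simp add: \<Psi>)
  qed
qed

lemma isometric_iso_trans:
  assumes "isometric_iso S N T M" and "isometric_iso T M U K"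
  shows "isometric_iso S N U K"
proof -
  obtain \<Phi> where \<Phi>: "bij_betw \<Phi> S T"
    "\<And>f g. f \<in> S \<Longrightarrow> g \<in> S \<Longrightarrow> \<Phi> (\<lambda>x. f x + g x) = (\<lambda>y. \<Phi> f y + \<Phi> g y)"
    "\<And>c f. f \<in> S \<Longrightarrow> \<Phi> (\<lambda>x. c * f x) = (\<lambda>y. c * \<Phi> f y)"
    "\<And>f. f \<in> S \<Longrightarrow> M (\<Phi> f) = N f"
    using assms(1) unfolding isometric_iso_def by blast
  obtain \<Psi> where \<Psi>: "bij_betw \<Psi> T U"
    "\<And>f g. f \<in> T \<Longrightarrow> g \<in> T \<Longrightarrow> \<Psi> (\<lambda>x. f x + g x) = (\<lambda>y. \<Psi> f y + \<Psi> g y)"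
    "\<And>c f. f \<in> T \<Longrightarrow> \<Psi> (\<lambda>x. c * f x) = (\<lambda>y. c * \<Psi> f y)"
    "\<And>f. f \<in> T \<Longrightarrow> K (\<Psi> f) = M f"
    using assms(2) unfolding isometric_iso_def by blast
  have in_T: "\<Phi> f \<in> T" if "f \<in> S" for f using \<Phi>(1) that by (auto simp: bij_betw_def)
  show ?thesis
    unfolding isometric_iso_def
    by (rule exI[of _ "\<Psi> \<circ> \<Phi>"]) (use \<Phi> \<Psi> in_T in \<open>auto simp: bij_betw_trans\<close>)
qed

section \<open>The space of primitives under the uniform norm\<close>

lemma continuous_limits_imp_bounded:
  fixes F :: "real \<Rightarrow> complex"
  assumes "continuous_on UNIV F" "(F \<longlongrightarrow> L) at_top" "(F \<longlongrightarrow> L') at_bot"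
  shows "bounded (range F)"
proof -
  obtain a where a: "\<And>x. x \<ge> a \<Longrightarrow> dist (F x) L < 1"
    using tendstoD[OF assms(2), of 1] by (auto simp: eventually_at_top_linorder)
  obtain b where b: "\<And>x. x \<le> b \<Longrightarrow> dist (F x) L' < 1"
    using tendstoD[OF assms(3), of 1] by (auto simp: eventually_at_bot_linorder)
  have "bounded (F ` {b..a})"
    by (intro compact_imp_bounded compact_continuous_image continuous_on_subset[OF assms(1)]) auto
  then have "bounded (F ` {b..a} \<union> ball L 1 \<union> ball L' 1)" by simp
  moreover have "range F \<subseteq> F ` {b..a} \<union> ball L 1 \<union> ball L' 1"
  proof
    fix y assume "y \<in> range F"
    then obtain x where "y = F x" by auto
    then show "y \<in> F ` {b..a} \<union> ball L 1 \<union> ball L' 1"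
      using a[of x] b[of x] by (cases "x \<ge> a"; cases "x \<le> b") (auto simp: dist_commute)
  qed
  ultimately show ?thesis using bounded_subset by blast
qed

lemma Bc_iff: "F \<in> Bc \<longleftrightarrow> continuous_on UNIV F \<and> (\<exists>L. (F \<longlongrightarrow> L) at_top) \<and> (F \<longlongrightarrow> 0) at_bot"
  by (auto simp: Bc_def ext_cont_def)

lemma Bc_bounded: "F \<in> Bc \<Longrightarrow> bounded (range F)"
  using continuous_limits_imp_bounded by (auto simp: Bc_iff)

text \<open>A supremum of reals bounds the values only when the range is bounded; continuity and the
  two limits at infinity guarantee this.\<close>

lemma Bc_le_supnorm:
  assumes "F \<in> Bc" shows "cmod (F x) \<le> supnorm F"
  unfolding supnorm_def
proof (rule cSUP_upper)
  show "bdd_above (range (\<lambda>x. cmod (F x)))"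
    using Bc_bounded[OF assms] by (auto simp: bounded_iff bdd_above_def)
qed simp

lemma supnorm_le: "(\<And>x. cmod (F x) \<le> B) \<Longrightarrow> supnorm F \<le> B"
  unfolding supnorm_def by (rule cSUP_least) auto

lemma cspace_Bc: "cspace Bc"
  unfolding cspace_def
proof (intro conjI ballI allI)
  show "(\<lambda>x. 0) \<in> Bc" by (auto simp: Bc_iff intro!: continuous_intros)
  show "(\<lambda>x. f x + g x) \<in> Bc" if fg: "f \<in> Bc" "g \<in> Bc" for f g
  proof -
    obtain L M where "(f \<longlongrightarrow> L) at_top" "(g \<longlongrightarrow> M) at_top" using fg by (auto simp: Bc_iff)
    then have "((\<lambda>x. f x + g x) \<longlongrightarrow> L + M) at_top" by (rule tendsto_add)
    moreover have "((\<lambda>x. f x + g x) \<longlongrightarrow> 0 + 0) at_bot"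
      using fg by (intro tendsto_add) (auto simp: Bc_iff)
    moreover have "continuous_on UNIV (\<lambda>x. f x + g x)"
      using fg by (intro continuous_on_add) (auto simp: Bc_iff)
    ultimately show ?thesis by (auto simp: Bc_iff)
  qed
  show "(\<lambda>x. c * f x) \<in> Bc" if f: "f \<in> Bc" for f c
  proof -
    obtain L where "(f \<longlongrightarrow> L) at_top" using f by (auto simp: Bc_iff)
    then have "((\<lambda>x. c * f x) \<longlongrightarrow> c * L) at_top" by (rule tendsto_mult_left)
    moreover have "((\<lambda>x. c * f x) \<longlongrightarrow> c * 0) at_bot"
      using f by (intro tendsto_mult_left) (auto simp: Bc_iff)
    moreover have "continuous_on UNIV (\<lambda>x. c * f x)"
      using f by (intro continuous_on_mult_left) (auto simp: Bc_iff)
    ultimately show ?thesis by (auto simp: Bc_iff)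
  qed
qed

lemma Bc_add: "F \<in> Bc \<Longrightarrow> G \<in> Bc \<Longrightarrow> (\<lambda>x. F x + G x) \<in> Bc"
  and Bc_scale: "F \<in> Bc \<Longrightarrow> (\<lambda>x. c * F x) \<in> Bc"
  using cspace_Bc by (auto simp: cspace_def)

lemma Bc_diff: "F \<in> Bc \<Longrightarrow> G \<in> Bc \<Longrightarrow> (\<lambda>x. F x - G x) \<in> Bc"
  using Bc_add[OF _ Bc_scale[of G "-1"], of F] by simp

lemma supnorm_scale:
  assumes "F \<in> Bc" shows "supnorm (\<lambda>x. c * F x) = cmod c * supnorm F"
proof (rule antisym)
  have cF: "(\<lambda>x. c * F x) \<in> Bc" by (rule Bc_scale[OF assms])
  show "supnorm (\<lambda>x. c * F x) \<le> cmod c * supnorm F"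
    by (rule supnorm_le) (simp add: norm_mult mult_left_mono Bc_le_supnorm[OF assms])
  show "cmod c * supnorm F \<le> supnorm (\<lambda>x. c * F x)"
  proof (cases "c = 0")
    case True
    then show ?thesis using Bc_le_supnorm[OF cF, of 0] by simp
  next
    case False
    have "supnorm F \<le> supnorm (\<lambda>x. c * F x) / cmod c"
      by (rule supnorm_le)
        (use Bc_le_supnorm[OF cF] False in \<open>simp add: norm_mult field_simps\<close>)
    then show ?thesis using False by (simp add: field_simps)
  qed
qed

lemma normed_on_Bc: "normed_on Bc supnorm"
  unfolding normed_on_def
proof (intro conjI ballI allI)
  show "0 \<le> supnorm f" if "f \<in> Bc" for f
    using Bc_le_supnorm[OF that, of 0] norm_ge_zero by (rule order_trans[rotated])
  show "supnorm f = 0 \<longleftrightarrow> f = (\<lambda>x. 0)" if "f \<in> Bc" for f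
    using Bc_le_supnorm[OF that] by (auto simp: supnorm_def)
  show "supnorm (\<lambda>x. f x + g x) \<le> supnorm f + supnorm g" if "f \<in> Bc" "g \<in> Bc" for f g
    by (rule supnorm_le) (meson Bc_le_supnorm that norm_triangle_le add_mono)
qed (rule supnorm_scale)

lemma complete_on_Bc: "complete_on Bc supnorm"
  unfolding complete_on_def
proof (intro allI impI)
  fix u :: "nat \<Rightarrow> real \<Rightarrow> complex"
  assume u: "\<forall>n. u n \<in> Bc"
    and C: "\<forall>e>0. \<exists>K. \<forall>m\<ge>K. \<forall>n\<ge>K. supnorm (\<lambda>x. u m x - u n x) < e"
  have uC: "\<exists>K. \<forall>x. \<forall>m\<ge>K. \<forall>n\<ge>K. dist (u m x) (u n x) < e" if e: "e > 0" for e
  proof -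
    from C e obtain K where "\<And>m n. m \<ge> K \<Longrightarrow> n \<ge> K \<Longrightarrow> supnorm (\<lambda>x. u m x - u n x) < e" by meson
    then show ?thesis
      using Bc_le_supnorm[OF Bc_diff] u unfolding dist_norm by (meson le_less_trans)
  qed
  then have "uniformly_Cauchy_on UNIV u" by (intro uniformly_Cauchy_onI) auto
  then obtain l where l: "uniform_limit UNIV u l sequentially"
    using Cauchy_uniformly_convergent uniformly_convergent_on_def by metis
  have lim: "\<exists>L. (l \<longlongrightarrow> L) at_top"
  proof -
    obtain T where T: "\<And>n. (u n \<longlongrightarrow> T n) at_top" using u unfolding Bc_iff by metis
    \<comment> \<open>The Cauchy estimate is uniform in the argument, so it passes to the limits at
      infinity. The strict bound may become an equality there, hence the estimate with
      \<open>e/2\<close>.\<close>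
    have "Cauchy T"
    proof (rule metric_CauchyI)
      fix e :: real assume "e > 0"
      with uC[of "e/2"] obtain K where K: "\<And>x m n. m \<ge> K \<Longrightarrow> n \<ge> K \<Longrightarrow> dist (u m x) (u n x) < e/2"
        by auto
      have "dist (T m) (T n) \<le> e/2" if "m \<ge> K" "n \<ge> K" for m n
        by (rule tendsto_upperbound[OF tendsto_dist[OF T T]])
          (use K[OF that] in \<open>auto intro!: always_eventually less_imp_le\<close>)
      with \<open>e > 0\<close> show "\<exists>M. \<forall>m\<ge>M. \<forall>n\<ge>M. dist (T m) (T n) < e"
        by (intro exI[of _ K]) fastforce
    qed
    then obtain L where "T \<longlonglongrightarrow> L" using Cauchy_convergent convergent_def by blast
    \<comment> \<open>Uniform convergence allows the limit in \<open>n\<close> and the limit at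
      infinity to be exchanged.\<close>
    then show ?thesis
      using swap_uniform_limit'[of u T at_top sequentially L UNIV l] T l by auto
  qed
  moreover have "(l \<longlongrightarrow> 0) at_bot"
    using swap_uniform_limit'[of u "\<lambda>_. 0" at_bot sequentially 0 UNIV l] u l by (auto simp: Bc_iff)
  moreover have "continuous_on UNIV l"
    by (rule uniform_limit_theorem[OF _ l]) (use u in \<open>auto simp: Bc_iff\<close>)
  ultimately have lB: "l \<in> Bc" by (auto simp: Bc_iff)
  have "(\<lambda>n. supnorm (\<lambda>x. u n x - l x)) \<longlonglongrightarrow> 0"
  proof (rule tendstoI)
    fix e :: real assume e: "e > 0"
    have "\<forall>\<^sub>F n in sequentially. \<forall>x. dist (u n x) (l x) < e/2"
      using uniform_limitD[OF l, of "e/2"] e by simp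
    then show "\<forall>\<^sub>F n in sequentially. dist (supnorm (\<lambda>x. u n x - l x)) 0 < e"
    proof eventually_elim
      case (elim n)
      have "supnorm (\<lambda>x. u n x - l x) \<le> e/2"
        by (rule supnorm_le) (use elim in \<open>auto simp: dist_norm less_imp_le\<close>)
      moreover have "0 \<le> supnorm (\<lambda>x. u n x - l x)"
        using normed_on_Bc Bc_diff u lB unfolding normed_on_def by blast
      ultimately show ?case using e by simp
    qed
  qed
  with lB show "\<exists>l\<in>Bc. (\<lambda>n. supnorm (\<lambda>x. u n x - l x)) \<longlonglongrightarrow> 0" by blast
qed

lemma banach_on_Bc: "banach_on Bc supnorm"
  by (simp add: banach_on_def cspace_Bc normed_on_Bc complete_on_Bc)

section \<open>Smooth functions and test functions\<close>

text \<open>Smoothness follows from membership in any class of functions closed under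
  differentiation, which avoids explicit formulas for iterated derivatives.\<close>

lemma smooth_fn_coinduct:
  assumes "P f"
    and "\<And>f. P f \<Longrightarrow> \<exists>f'. (\<forall>x. (f has_real_derivative f' x) (at x)) \<and> P f'"
  shows "smooth_fn f"
proof -
  have step: "P (deriv g) \<and> (\<forall>x. g differentiable (at x))" if "P g" for g
  proof -
    from assms(2)[OF that] obtain g' where g': "\<And>x. (g has_real_derivative g' x) (at x)" "P g'"
      by blast
    then have "deriv g = g'" by (auto intro!: ext DERIV_imp_deriv)
    with g' show ?thesis by (auto simp: real_differentiable_def)
  qed
  have "P ((deriv ^^ k) f)" for k by (induction k) (use assms(1) step in auto)
  with step show ?thesis by (simp add: smooth_fn_def)
qed

lemma smooth_fn_has_derivative:
  assumes "smooth_fn f" shows "(f has_real_derivative deriv f x) (at x)"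
proof -
  have "f differentiable (at x)" using assms[unfolded smooth_fn_def, rule_format, of 0] by simp
  then show ?thesis by (metis DERIV_imp_deriv real_differentiable_def)
qed

lemma smooth_fn_deriv: "smooth_fn f \<Longrightarrow> smooth_fn (deriv f)"
  unfolding smooth_fn_def by (metis funpow_Suc_right comp_apply)

lemma smooth_fn_continuous: "smooth_fn f \<Longrightarrow> continuous_on UNIV f"
  using smooth_fn_has_derivative DERIV_isCont continuous_at_imp_continuous_on by blast

text \<open>The Leibniz rule turns a product into a sum of two products, so products alone are not
  closed under differentiation; their finite sums are.\<close>

inductive prod_sum :: "(real \<Rightarrow> real) \<Rightarrow> bool" where
  prod: "smooth_fn f \<Longrightarrow> smooth_fn g \<Longrightarrow> prod_sum (\<lambda>x. f x * g x)"
| sum: "prod_sum f \<Longrightarrow> prod_sum g \<Longrightarrow> prod_sum (\<lambda>x. f x + g x)"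

lemma smooth_fn_mult:
  assumes "smooth_fn f" "smooth_fn g" shows "smooth_fn (\<lambda>x. f x * g x)"
proof (rule smooth_fn_coinduct[of prod_sum])
  show "\<exists>f'. (\<forall>x. (f has_real_derivative f' x) (at x)) \<and> prod_sum f'" if "prod_sum f" for f
    using that
  proof induction
    case (prod f g)
    then show ?case
      by (intro exI[of _ "\<lambda>x. deriv f x * g x + f x * deriv g x"] conjI allI prod_sum.intros smooth_fn_deriv)
        (auto intro!: derivative_eq_intros smooth_fn_has_derivative)
  next
    case (sum f g)
    then obtain f' g' where "\<And>x. (f has_real_derivative f' x) (at x)" "prod_sum f'"
      "\<And>x. (g has_real_derivative g' x) (at x)" "prod_sum g'" by blast
    then show ?case
      by (intro exI[of _ "\<lambda>x. f' x + g' x"]) (auto intro!: derivative_eq_intros prod_sum.sum)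
  qed
qed (use assms in \<open>rule prod_sum.prod\<close>)

text \<open>The invariant class allows scalar multiples because each differentiation contributes a
  factor \<open>b\<close> by the chain rule.\<close>

lemma smooth_fn_affine:
  assumes "smooth_fn f" shows "smooth_fn (\<lambda>x. f (a + b * x))"
proof (rule smooth_fn_coinduct[of "\<lambda>g. \<exists>f c. smooth_fn f \<and> g = (\<lambda>x. c * f (a + b * x))"])
  show "\<exists>h c. smooth_fn h \<and> (\<lambda>x. f (a + b * x)) = (\<lambda>x. c * h (a + b * x))"
    using assms by (intro exI[of _ f] exI[of _ 1]) auto
  fix g assume "\<exists>f c. smooth_fn f \<and> g = (\<lambda>x. c * f (a + b * x))"
  then obtain f c where f: "smooth_fn f" "g = (\<lambda>x. c * f (a + b * x))" by blast
  have "(g has_real_derivative c * (deriv f (a + b * x) * b)) (at x)" for x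
    unfolding f(2)
    by (intro DERIV_cmult DERIV_chain2[OF smooth_fn_has_derivative[OF f(1)]])
      (auto intro!: derivative_eq_intros)
  then have "\<forall>x. (g has_real_derivative (c * b) * deriv f (a + b * x)) (at x)"
    by (simp add: mult_ac)
  with smooth_fn_deriv[OF f(1)] show "\<exists>g'. (\<forall>x. (g has_real_derivative g' x) (at x)) \<and>
      (\<exists>f c. smooth_fn f \<and> g' = (\<lambda>x. c * f (a + b * x)))"
    by (intro exI[of _ "\<lambda>x. (c * b) * deriv f (a + b * x)"]) blast
qed

lemma smooth_fn_trig: "smooth_fn (\<lambda>x. c * cos (a * x) + d * sin (a * x))"
proof (rule smooth_fn_coinduct[of "\<lambda>g. \<exists>c d. g = (\<lambda>x. c * cos (a * x) + d * sin (a * x))"])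
  fix g assume "\<exists>c d. g = (\<lambda>x. c * cos (a * x) + d * sin (a * x))"
  then obtain c d where "g = (\<lambda>x. c * cos (a * x) + d * sin (a * x))" by blast
  then have "\<forall>x. (g has_real_derivative (d * a) * cos (a * x) + (- c * a) * sin (a * x)) (at x)"
    by (auto intro!: derivative_eq_intros)
  then show "\<exists>g'. (\<forall>x. (g has_real_derivative g' x) (at x)) \<and>
      (\<exists>c d. g' = (\<lambda>x. c * cos (a * x) + d * sin (a * x)))"
    by (intro exI[of _ "\<lambda>x. (d * a) * cos (a * x) + (- c * a) * sin (a * x)"]) blast
qed blast

lemma smooth_fn_ident: "smooth_fn (\<lambda>x. x)"
proof (rule smooth_fn_coinduct[of "\<lambda>g. \<exists>a b. g = (\<lambda>x. a * x + b)"])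
  show "\<exists>a b. (\<lambda>x::real. x) = (\<lambda>x. a * x + b)" by (rule exI[of _ 1], rule exI[of _ 0]) simp
  fix g :: "real \<Rightarrow> real" assume "\<exists>a b. g = (\<lambda>x. a * x + b)"
  then obtain a b where "g = (\<lambda>x. a * x + b)" by blast
  then have "\<forall>x. (g has_real_derivative 0 * x + a) (at x)"
    by (auto intro!: derivative_eq_intros)
  then show "\<exists>g'. (\<forall>x. (g has_real_derivative g' x) (at x)) \<and> (\<exists>a b. g' = (\<lambda>x. a * x + b))"
    by (intro exI[of _ "\<lambda>x. 0 * x + a"]) blast
qed

text \<open>Only the support needs an argument: on the open complement of a closed ball containing
  the support, the function is locally zero, and so is its derivative.\<close>

lemma test_fn_deriv:
  assumes "test_fn f" shows "test_fn (deriv f)"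
proof -
  obtain R where R: "\<And>x. f x \<noteq> 0 \<Longrightarrow> norm x \<le> R"
    using assms by (auto simp: test_fn_def bounded_iff)
  have "norm x \<le> R" if "deriv f x \<noteq> 0" for x
  proof (rule ccontr)
    assume "\<not> norm x \<le> R"
    then have x: "x \<in> - cball 0 R" by simp
    have "((\<lambda>x. 0) has_real_derivative 0) (at x)" by simp
    then have "(f has_real_derivative 0) (at x)"
      by (rule has_field_derivative_transform_within_open[where S = "- cball 0 R"])
        (use x R in auto)
    with that show False using DERIV_imp_deriv by blast
  qed
  with assms show ?thesis by (auto simp: test_fn_def smooth_fn_deriv bounded_iff)
qed

lemma test_fn_mult: "smooth_fn f \<Longrightarrow> test_fn g \<Longrightarrow> test_fn (\<lambda>x. f x * g x)"
  by (auto simp: test_fn_def smooth_fn_mult intro: bounded_subset)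

lemma test_fn_affine:
  assumes "test_fn f" "b \<noteq> 0" shows "test_fn (\<lambda>x. f (a + b * x))"
proof -
  obtain R where R: "\<And>x. f x \<noteq> 0 \<Longrightarrow> norm x \<le> R"
    using assms by (auto simp: test_fn_def bounded_iff)
  have "norm x \<le> (R + \<bar>a\<bar>) / \<bar>b\<bar>" if "f (a + b * x) \<noteq> 0" for x
  proof -
    have "\<bar>b * x\<bar> \<le> R + \<bar>a\<bar>" using R[OF that] by simp
    then have "\<bar>b\<bar> * \<bar>x\<bar> \<le> R + \<bar>a\<bar>" by (simp add: abs_mult)
    then show ?thesis using assms(2) by (simp add: pos_le_divide_eq mult.commute)
  qed
  then have "bounded {x. f (a + b * x) \<noteq> 0}" unfolding bounded_iff by blast
  then show ?thesis using assms(1) by (simp add: test_fn_def smooth_fn_affine)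
qed

section \<open>Construction of a bump function\<close>

definition exp_cutoff :: "real poly \<Rightarrow> real \<Rightarrow> real" where
  "exp_cutoff p x = (if x > 0 then poly p (1 / x) / exp (1 / x) else 0)"

lemma poly_div_exp_tendsto_0: "((\<lambda>x. poly p x / exp x) \<longlongrightarrow> (0::real)) at_top"
proof -
  have "((\<lambda>x. \<Sum>i\<le>degree p. coeff p i * (x ^ i / exp x)) \<longlongrightarrow> (\<Sum>i\<le>degree p. coeff p i * 0)) at_top"
    by (intro tendsto_intros tendsto_power_div_exp_0)
  then show ?thesis by (simp add: poly_altdef sum_divide_distrib)
qed

text \<open>The polynomial parameter makes the family closed under differentiation: with
  \<open>y = 1 / x\<close>, the function \<open>p(y) exp(-y)\<close> has \<open>x\<close>-derivative
  \<open>y^2 (p - p')(y) exp(-y)\<close>, and \<open>[:0, 0, 1:]\<close> is that factor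
  \<open>y^2\<close>.\<close>

lemma exp_cutoff_has_derivative:
  "(exp_cutoff p has_real_derivative exp_cutoff ([:0, 0, 1:] * (p - pderiv p)) x) (at x)"
proof (cases x "0::real" rule: linorder_cases)
  case less
  have "((\<lambda>x. 0) has_real_derivative 0) (at x)" by simp
  then show ?thesis
    by (rule has_field_derivative_transform_within_open[where S = "{..<0}", THEN DERIV_cong])
      (use less in \<open>auto simp: exp_cutoff_def\<close>)
next
  case greater
  have "((\<lambda>x. poly p (1 / x) / exp (1 / x)) has_real_derivative
      exp_cutoff ([:0, 0, 1:] * (p - pderiv p)) x) (at x)"
  proof (rule DERIV_cong)
    show "((\<lambda>x. poly p (1 / x) / exp (1 / x)) has_real_derivative
        ((poly (pderiv p) (1 / x) * (- 1 / x\<^sup>2)) * exp (1 / x)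
          - poly p (1 / x) * (exp (1 / x) * (- 1 / x\<^sup>2))) / (exp (1 / x) * exp (1 / x))) (at x)"
      by (intro DERIV_divide DERIV_chain2[OF poly_DERIV] DERIV_chain2[OF DERIV_exp])
        (use greater in \<open>auto intro!: derivative_eq_intros simp: power2_eq_square\<close>)
    have "((Q * (- 1 / x\<^sup>2)) * E - P * (E * (- 1 / x\<^sup>2))) / (E * E) = (1 / x) * ((1 / x) * (P - Q)) / E"
      if "E \<noteq> 0" for P Q E :: real
      using that greater by (simp add: field_simps power2_eq_square)
    from this[of "exp (1 / x)"] show "((poly (pderiv p) (1 / x) * (- 1 / x\<^sup>2)) * exp (1 / x)
          - poly p (1 / x) * (exp (1 / x) * (- 1 / x\<^sup>2))) / (exp (1 / x) * exp (1 / x))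
        = exp_cutoff ([:0, 0, 1:] * (p - pderiv p)) x"
      using greater by (simp add: exp_cutoff_def)
  qed
  then show ?thesis
    by (rule has_field_derivative_transform_within_open[where S = "{0<..}"])
      (use greater in \<open>auto simp: exp_cutoff_def\<close>)
next
  case equal
  \<comment> \<open>To the right of 0 the difference quotient is \<open>y p(y) / exp y\<close> with
    \<open>y = 1 / h\<close> tending to infinity; the factor \<open>y\<close> is absorbed into the
    polynomial as \<open>[:0, 1:]\<close>.\<close>
  have "((\<lambda>h. exp_cutoff p h / h) \<longlongrightarrow> 0) (at 0)"
  proof (rule filterlim_split_at)
    show "((\<lambda>h. exp_cutoff p h / h) \<longlongrightarrow> 0) (at_left 0)"
      by (rule tendsto_eventually) (auto simp: exp_cutoff_def eventually_at_filter)
    have "((\<lambda>h. poly ([:0, 1:] * p) (inverse h) / exp (inverse h)) \<longlongrightarrow> (0::real)) (at_right 0)"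
      by (rule filterlim_compose[OF poly_div_exp_tendsto_0 filterlim_inverse_at_top_right])
    then show "((\<lambda>h. exp_cutoff p h / h) \<longlongrightarrow> 0) (at_right 0)"
      by (rule Lim_transform_eventually)
        (auto simp: exp_cutoff_def eventually_at_filter field_simps)
  qed
  then show ?thesis using equal by (simp add: DERIV_def exp_cutoff_def)
qed

lemma smooth_fn_exp_cutoff: "smooth_fn (exp_cutoff p)"
  by (rule smooth_fn_coinduct[of "\<lambda>f. \<exists>p. f = exp_cutoff p"])
    (use exp_cutoff_has_derivative in blast)+

lemma bump_exists: "\<exists>\<psi>. test_fn \<psi> \<and> (\<forall>x. \<psi> x \<ge> 0) \<and> \<psi> 0 > 0"
proof -
  \<comment> \<open>The factors vanish for \<open>x \<le> -1\<close> and for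
    \<open>x \<ge> 1\<close> respectively. The arguments are spelled out to match
    \<open>smooth_fn_affine\<close>.\<close>
  define \<psi> where "\<psi> x = exp_cutoff 1 (1 + 1 * x) * exp_cutoff 1 (1 + (-1) * x)" for x
  have "smooth_fn \<psi>" unfolding \<psi>_def
    by (intro smooth_fn_mult smooth_fn_affine smooth_fn_exp_cutoff)
  moreover have "norm x \<le> 1" if "\<psi> x \<noteq> 0" for x
    using that by (auto simp: \<psi>_def exp_cutoff_def split: if_splits)
  ultimately have "test_fn \<psi>" by (auto simp: test_fn_def bounded_iff)
  then show ?thesis by (intro exI[of _ \<psi>]) (auto simp: \<psi>_def exp_cutoff_def)
qed

section \<open>Correlation with decaying kernels\<close>

lemma integrable_inverse_square_weight: "integrable lborel (\<lambda>x::real. C / (1 + x\<^sup>2))"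
proof -
  have "integrable lborel (\<lambda>x::real. inverse (1 + x\<^sup>2))"
    using integrable_inverse_1_plus_square by (simp add: set_integrable_def)
  then have "integrable lborel (\<lambda>x::real. C * inverse (1 + x\<^sup>2))" by (rule integrable_mult_right)
  then show ?thesis by (simp add: divide_inverse)
qed

lemma one_plus_sq_pos: "0 < 1 + (x::real)\<^sup>2"
  by (simp add: add_pos_nonneg)

lemma integrable_bounded_times_decay:
  fixes F k :: "real \<Rightarrow> complex"
  assumes [measurable]: "F \<in> borel_measurable borel" "k \<in> borel_measurable borel"
    and F: "\<And>x. cmod (F x) \<le> B" and k: "\<And>x. cmod (k x) \<le> C / (1 + x\<^sup>2)"
  shows "integrable lborel (\<lambda>x. F x * k x)"
proof (rule Bochner_Integration.integrable_bound[OF integrable_inverse_square_weight[of "B * C"]])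
  have "cmod (F x * k x) \<le> B * (C / (1 + x\<^sup>2))" for x
    unfolding norm_mult by (intro mult_mono F k) (use order_trans[OF norm_ge_zero F] in auto)
  then show "AE x in lborel. norm (F x * k x) \<le> norm (B * C / (1 + x\<^sup>2))"
    using order_trans[OF _ abs_ge_self] by (intro AE_I2) fastforce
qed measurable

text \<open>Supplies the hypothesis of Fubini's theorem: a majorant that is a product of integrable
  functions of one variable each is integrable on the plane.\<close>

lemma integrable_pair_dominated:
  fixes f :: "real \<Rightarrow> real \<Rightarrow> complex" and p q :: "real \<Rightarrow> real"
  assumes f[measurable]: "case_prod f \<in> borel_measurable (lborel \<Otimes>\<^sub>M lborel)"
    and p: "integrable lborel p" and q: "integrable lborel q"
    and le: "\<And>x y. cmod (f x y) \<le> p x * q y"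
  shows "integrable (lborel \<Otimes>\<^sub>M lborel) (case_prod f)"
proof (rule Bochner_Integration.integrable_bound)
  note [measurable] = borel_measurable_integrable[OF p] borel_measurable_integrable[OF q]
  show "integrable (lborel \<Otimes>\<^sub>M lborel) (\<lambda>(x, y). p x * q y)"
    by (rule lborel_pair.Fubini_integrable) (use p q in \<open>auto simp: abs_mult\<close>)
  show "AE z in lborel \<Otimes>\<^sub>M lborel. norm (case_prod f z) \<le> norm (case z of (x, y) \<Rightarrow> p x * q y)"
    using le by (auto intro!: AE_I2 order_trans[OF _ abs_ge_self])
qed measurable

lemma Bc_affine:
  assumes "F \<in> Bc" "b > 0" shows "(\<lambda>x. F (a + b * x)) \<in> Bc"
proof -
  have top: "filterlim (\<lambda>x. a + b * x) at_top at_top" and bot: "filterlim (\<lambda>x. a + b * x) at_bot at_bot"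
    using assms(2) by real_asymp+
  obtain L where L: "(F \<longlongrightarrow> L) at_top" and 0: "(F \<longlongrightarrow> 0) at_bot" and c: "continuous_on UNIV F"
    using assms(1) by (auto simp: Bc_iff)
  have "continuous_on UNIV (\<lambda>x. F (a + b * x))"
    by (rule continuous_on_compose2[OF c]) (auto intro!: continuous_intros)
  then show ?thesis
    using filterlim_compose[OF L top] filterlim_compose[OF 0 bot] by (auto simp: Bc_iff)
qed

lemma Bc_measurable: "F \<in> Bc \<Longrightarrow> F \<in> borel_measurable borel"
  by (simp add: Bc_iff borel_measurable_continuous_onI)

text \<open>Quadratic decay is a property shared by test functions and their Fourier transforms. It
  is integrable and, up to a constant, survives bounded translations, so both injectivity proofs can
  use the same argument.\<close>

locale decaying_kernel =
  fixes k k' :: "real \<Rightarrow> complex" and C :: real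
  assumes deriv: "\<And>x. (k has_vector_derivative k' x) (at x)"
    and cont': "continuous_on UNIV k'"
    and decay: "\<And>x. cmod (k x) \<le> C / (1 + x\<^sup>2)"
    and decay': "\<And>x. cmod (k' x) \<le> C / (1 + x\<^sup>2)"
begin

lemma cont: "continuous_on UNIV k"
  using deriv has_vector_derivative_continuous continuous_at_imp_continuous_on by blast

lemma measurable [measurable]: "k \<in> borel_measurable borel" "k' \<in> borel_measurable borel"
  using cont cont' by (auto intro: borel_measurable_continuous_onI)

lemma nonneg: "0 \<le> C"
  using order_trans[OF norm_ge_zero decay[of 0]] by simp

text \<open>Formally the derivative of the correlation in the shift is minus the integral against
  \<open>k'\<close>, which vanishes. Instead of differentiating under the integral, the vanishing
  integrals are integrated over \<open>{a..b}\<close>; exchanging the order and using the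
  fundamental theorem in the shift gives the difference of the two correlations.\<close>

lemma correlation_const:
  assumes F: "F \<in> Bc" and zero: "\<And>a. (LINT t|lborel. F t * k' (t - a)) = 0" and ab: "a \<le> b"
  shows "(LINT t|lborel. F t * k (t - a)) = (LINT t|lborel. F t * k (t - b))"
proof -
  note [measurable] = Bc_measurable[OF F]
  \<comment> \<open>A decay constant valid for all shifts in \<open>{a..b}\<close>, obtained from
    \<open>1 + t^2 \<le> 2 (1 + u^2) (1 + (t - u)^2)\<close> and
    \<open>u^2 \<le> (|a| + |b|)^2\<close>.\<close>
  define D where "D = 2 * C * (1 + (\<bar>a\<bar> + \<bar>b\<bar>)\<^sup>2)"
  have shift: "C / (1 + (t - u)\<^sup>2) \<le> D / (1 + t\<^sup>2)" if "u \<in> {a..b}" for t u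
  proof -
    have "u\<^sup>2 \<le> (\<bar>a\<bar> + \<bar>b\<bar>)\<^sup>2" using that by (intro abs_le_square_iff[THEN iffD1]) auto
    moreover have "1 + t\<^sup>2 \<le> 2 * (1 + u\<^sup>2) * (1 + (t - u)\<^sup>2)"
    proof -
      \<comment> \<open>This expression is exactly the right-hand side minus the left-hand side of
        the claimed inequality.\<close>
      have "0 \<le> (t - 2 * u)\<^sup>2 + 1 + 2 * (u * (t - u))\<^sup>2" by simp
      then show ?thesis by (simp add: power2_eq_square algebra_simps)
    qed
    moreover from this have "2 * (1 + u\<^sup>2) * (1 + (t - u)\<^sup>2) \<le> 2 * (1 + (\<bar>a\<bar> + \<bar>b\<bar>)\<^sup>2) * (1 + (t - u)\<^sup>2)"
      using \<open>u\<^sup>2 \<le> _\<close> by (intro mult_right_mono) auto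
    ultimately have "1 + t\<^sup>2 \<le> 2 * (1 + (\<bar>a\<bar> + \<bar>b\<bar>)\<^sup>2) * (1 + (t - u)\<^sup>2)"
      by (meson order_trans)
    from mult_left_mono[OF this nonneg] have "C * (1 + t\<^sup>2) \<le> D * (1 + (t - u)\<^sup>2)"
      by (simp only: D_def mult_ac)
    then show ?thesis by (simp add: pos_le_divide_eq pos_divide_le_eq one_plus_sq_pos)
  qed
  have int: "integrable lborel (\<lambda>t. F t * k (t - u))" if "u \<in> {a..b}" for u
    by (rule integrable_bounded_times_decay[OF _ _ Bc_le_supnorm[OF F], where C = D])
      (use order_trans[OF decay shift[OF that]] in auto)
  define f where "f t u = indicator {a..b} u *\<^sub>R (F t * k' (t - u))" for t u
  have "integrable (lborel \<Otimes>\<^sub>M lborel) (case_prod f)"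
  proof (rule integrable_pair_dominated)
    show "case_prod f \<in> borel_measurable (lborel \<Otimes>\<^sub>M lborel)"
      unfolding f_def by measurable
    show "integrable lborel (\<lambda>t. supnorm F * D / (1 + t\<^sup>2))"
      by (rule integrable_inverse_square_weight)
    show "integrable lborel (indicator {a..b} :: real \<Rightarrow> real)" by (simp add: emeasure_lborel_Icc_eq)
    fix t u
    have "cmod (F t * k' (t - u)) \<le> supnorm F * (D / (1 + t\<^sup>2))" if "u \<in> {a..b}"
      unfolding norm_mult
      by (intro mult_mono Bc_le_supnorm[OF F] order_trans[OF decay' shift[OF that]])
        (use order_trans[OF norm_ge_zero Bc_le_supnorm[OF F]] in auto)
    then show "cmod (f t u) \<le> supnorm F * D / (1 + t\<^sup>2) * indicator {a..b} u"
      by (auto simp: f_def indicator_def)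
  qed
  then have "(LINT u|lborel. LINT t|lborel. f t u) = (LINT t|lborel. LINT u|lborel. f t u)"
    by (rule lborel_pair.Fubini_integral)
  moreover have "(LINT t|lborel. f t u) = 0" for u
    unfolding f_def using zero[of u] by simp
  moreover have "(LINT u|lborel. f t u) = F t * k (t - a) - F t * k (t - b)" for t
  proof -
    have "(LINT u|lborel. indicator {a..b} u *\<^sub>R (F t * k' (t - u)))
        = - (F t * k (t - b)) - - (F t * k (t - a))"
    proof (rule integral_FTC_atLeastAtMost[OF ab])
      show "((\<lambda>u. - (F t * k (t - u))) has_vector_derivative F t * k' (t - u)) (at u within {a..b})" for u
      proof -
        have "((\<lambda>u. k (t - u)) has_vector_derivative (- 1) *\<^sub>R k' (t - u)) (at u within {a..b})"
          by (rule vector_diff_chain_within[of "\<lambda>u. t - u", unfolded o_def])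
            (auto intro!: derivative_eq_intros has_vector_derivative_at_within[OF deriv])
        then show ?thesis by (auto intro!: derivative_eq_intros)
      qed
      show "continuous_on {a..b} (\<lambda>u. F t * k' (t - u))"
        by (intro continuous_intros continuous_on_compose2[OF cont']) auto
    qed
    then show ?thesis by (simp add: f_def)
  qed
  ultimately show ?thesis using int[of a] int[of b] ab by simp
qed

text \<open>The correlation does not depend on the shift, and as the shift tends to minus infinity
  it converges to 0 by dominated convergence. Here the normalization
  \<open>F(-\<infinity>) = 0\<close> enters: a nonzero constant \<open>F\<close> is also orthogonal
  to all translates of \<open>k'\<close>.\<close>

lemma correlation_zero:
  assumes F: "F \<in> Bc" and zero: "\<And>a. (LINT t|lborel. F t * k' (t - a)) = 0"
  shows "(LINT u|lborel. F (a + u) * k u) = 0"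
proof -
  note [measurable] = Bc_measurable[OF F]
  define H where "H a = (LINT u|lborel. F (a + u) * k u)" for a
  have H: "H a = (LINT t|lborel. F t * k (t - a))" for a
    unfolding H_def by (subst lborel_integral_real_affine[of 1 _ a]) auto
  have const: "H a = H b" for a b
    unfolding H
    by (metis correlation_const[OF F zero] le_cases)
  have "(\<lambda>n. H (- real n)) \<longlonglongrightarrow> (LINT u::real|lborel. 0)"
    unfolding H_def
  proof (rule integral_dominated_convergence[where w = "\<lambda>u. supnorm F * C / (1 + u\<^sup>2)"])
    show "integrable lborel (\<lambda>u. supnorm F * C / (1 + u\<^sup>2))"
      by (rule integrable_inverse_square_weight)
    show "AE u in lborel. (\<lambda>n. F (- real n + u) * k u) \<longlonglongrightarrow> 0"
    proof (rule AE_I2)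
      fix u
      have "filterlim (\<lambda>n. - real n + u) at_bot sequentially" by real_asymp
      then have "(\<lambda>n. F (- real n + u)) \<longlonglongrightarrow> 0"
        by (rule filterlim_compose[rotated]) (use F in \<open>simp add: Bc_iff\<close>)
      then show "(\<lambda>n. F (- real n + u) * k u) \<longlonglongrightarrow> 0" by (rule tendsto_mult_left_zero)
    qed
    have "cmod (F (- real n + u) * k u) \<le> supnorm F * (C / (1 + u\<^sup>2))" for n u
      unfolding norm_mult
      by (intro mult_mono Bc_le_supnorm[OF F] decay)
        (use order_trans[OF norm_ge_zero Bc_le_supnorm[OF F]] in auto)
    then show "AE u in lborel. norm (F (- real n + u) * k u) \<le> supnorm F * C / (1 + u\<^sup>2)" for n
      by simp
  qed measurable
  moreover have "(\<lambda>n. H (- real n)) = (\<lambda>n. H a)" by (rule ext) (rule const)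
  ultimately show ?thesis unfolding H_def[symmetric] by (simp add: LIMSEQ_const_iff)
qed

text \<open>An approximate identity argument: \<open>k\<close> rescaled by a small \<epsilon>
  concentrates at \<open>x\<close>, so the vanishing correlations converge to \<open>F x\<close>
  times the mass of \<open>k\<close>.\<close>

lemma eq_zero_if_correlations_zero:
  assumes F: "F \<in> Bc" and mass: "(LINT u|lborel. k u) \<noteq> 0"
    and zero: "\<And>a \<epsilon>. \<epsilon> > 0 \<Longrightarrow> (LINT t|lborel. F t * k' ((t - a) / \<epsilon>)) = 0"
  shows "F = (\<lambda>x. 0)"
proof
  note [measurable] = Bc_measurable[OF F]
  fix x
  \<comment> \<open>Substituting \<open>x + \<epsilon> * t\<close> moves the dilation from the
    kernel to \<open>F\<close>. The rescaled function stays in \<open>Bc\<close>, so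
    \<open>correlation_zero\<close> applies to it with the undilated kernel.\<close>
  have scaled: "(LINT u|lborel. F (x + \<epsilon> * u) * k u) = 0" if \<epsilon>: "\<epsilon> > 0" for \<epsilon>
  proof -
    have "(LINT t|lborel. F (x + \<epsilon> * t) * k' (t - a)) = 0" for a
    proof -
      have "(LINT t|lborel. F t * k' ((t - (x + \<epsilon> * a)) / \<epsilon>))
          = \<epsilon> *\<^sub>R (LINT t|lborel. F (x + \<epsilon> * t) * k' (t - a))"
        using \<epsilon> by (subst lborel_integral_real_affine[of \<epsilon> _ x])
          (auto simp: diff_divide_distrib add_divide_distrib)
      with zero[OF \<epsilon>] \<epsilon> show ?thesis by simp
    qed
    from correlation_zero[OF Bc_affine[OF F \<epsilon>] this, of 0] show ?thesis by simp
  qed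
  have "(\<lambda>n. LINT u|lborel. F (x + inverse (real (Suc n)) * u) * k u) \<longlonglongrightarrow> (LINT u|lborel. F x * k u)"
  proof (rule integral_dominated_convergence[OF _ _ integrable_inverse_square_weight[of "supnorm F * C"]])
    show "AE u in lborel. (\<lambda>n. F (x + inverse (real (Suc n)) * u) * k u) \<longlonglongrightarrow> F x * k u"
    proof (rule AE_I2)
      fix u
      have "(\<lambda>n. x + inverse (real (Suc n)) * u) \<longlonglongrightarrow> x" by real_asymp
      moreover have "isCont F x" using F by (auto simp: Bc_iff continuous_on_eq_continuous_at)
      ultimately show "(\<lambda>n. F (x + inverse (real (Suc n)) * u) * k u) \<longlonglongrightarrow> F x * k u"
        by (intro tendsto_intros isCont_tendsto_compose[of x F])
    qed
    have "cmod (F (x + inverse (real (Suc n)) * u) * k u) \<le> supnorm F * (C / (1 + u\<^sup>2))" for n u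
      unfolding norm_mult
      by (intro mult_mono Bc_le_supnorm[OF F] decay)
        (use order_trans[OF norm_ge_zero Bc_le_supnorm[OF F]] in auto)
    then show "AE u in lborel. norm (F (x + inverse (real (Suc n)) * u) * k u) \<le> supnorm F * C / (1 + u\<^sup>2)" for n
      by simp
  qed measurable
  moreover have "(LINT u|lborel. F (x + inverse (real (Suc n)) * u) * k u) = 0" for n
    by (rule scaled) simp
  ultimately have "(\<lambda>n::nat. 0) \<longlonglongrightarrow> F x * (LINT u|lborel. k u)" by simp
  then show "F x = 0" using mass by (simp add: LIMSEQ_const_iff)
qed

end

section \<open>Fourier transforms of test functions\<close>

text \<open>The integrand vanishes almost everywhere, and its zero set is closed; a closed set of
  full measure is the whole line.\<close>

lemma continuous_nonneg_LINT_eq_0: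
  fixes f :: "real \<Rightarrow> real"
  assumes c: "continuous_on UNIV f" and pos: "\<And>x. 0 \<le> f x" and i: "integrable lborel f"
    and z: "(LINT x|lborel. f x) = 0"
  shows "f x = 0"
proof -
  have "AE x in lborel. f x = 0"
    using integral_nonneg_eq_0_iff_AE[OF i] pos z by simp
  then have "AE x in lebesgue. x \<in> {x. f x = 0}"
    using AE_completion[of "\<lambda>x. f x = 0" lborel] by simp
  moreover have "closed {x. f x = 0}"
    by (intro closed_Collect_eq c continuous_on_const)
  ultimately show ?thesis using mem_closed_if_AE_lebesgue[of "{x. f x = 0}" x] by simp
qed

section \<open>Integration against test functions\<close>

lemma test_fn_support:
  assumes "test_fn \<phi>"
  obtains R where "R > 0" "\<And>x. R \<le> \<bar>x\<bar> \<Longrightarrow> \<phi> x = 0"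
proof -
  obtain R where R: "\<And>x. \<phi> x \<noteq> 0 \<Longrightarrow> norm x \<le> R"
    using assms by (auto simp: test_fn_def bounded_iff)
  show ?thesis
  \<comment> \<open>Enlarging the radius by one makes it positive and makes the function vanish
    already at the radius itself, which later removes boundary terms.\<close>
  proof (rule that[of "\<bar>R\<bar> + 1"])
    show "\<phi> x = 0" if "\<bar>R\<bar> + 1 \<le> \<bar>x\<bar>" for x
      using R[of x] that by (cases "\<phi> x = 0") auto
  qed auto
qed

lemma test_fn_continuous: "test_fn \<phi> \<Longrightarrow> continuous_on S \<phi>"
  using continuous_on_subset[OF smooth_fn_continuous] by (auto simp: test_fn_def)

lemma test_fn_measurable: "test_fn \<phi> \<Longrightarrow> \<phi> \<in> borel_measurable borel"
  by (simp add: borel_measurable_continuous_onI test_fn_continuous)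

lemma test_fn_integrable:
  fixes G :: "real \<Rightarrow> 'a::{banach, second_countable_topology}"
  assumes "test_fn \<phi>" "continuous_on UNIV G"
  shows "integrable lborel (\<lambda>x. \<phi> x *\<^sub>R G x)"
proof -
  obtain R where R: "R > 0" "\<And>x. R \<le> \<bar>x\<bar> \<Longrightarrow> \<phi> x = 0"
    using test_fn_support[OF assms(1)] by blast
  have "integrable lborel (\<lambda>x. indicator {-R..R} x *\<^sub>R (\<phi> x *\<^sub>R G x))"
    by (intro borel_integrable_compact continuous_intros test_fn_continuous assms
        continuous_on_subset[OF assms(2)]) auto
  also have "(\<lambda>x. indicator {-R..R} x *\<^sub>R (\<phi> x *\<^sub>R G x)) = (\<lambda>x. \<phi> x *\<^sub>R G x)"
  proof
    show "indicator {-R..R} x *\<^sub>R (\<phi> x *\<^sub>R G x) = \<phi> x *\<^sub>R G x" for x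
      using R(2)[of x] by (cases "R \<le> \<bar>x\<bar>") (auto simp: indicator_def)
  qed
  finally show ?thesis .
qed

lemma test_fn_times_integrable:
  assumes "test_fn \<phi>" "continuous_on UNIV G"
  shows "integrable lborel (\<lambda>x. complex_of_real (\<phi> x) * G x)"
  using test_fn_integrable[OF assms] by (simp add: scaleR_conv_of_real)

text \<open>\<open>dist_fun\<close> uses the gauge integral; for continuous \<open>G\<close> it
  agrees with the Lebesgue integral, to which Fubini and dominated convergence apply.\<close>

lemma dist_fun_eq_LINT:
  assumes "test_fn \<phi>" "continuous_on UNIV G"
  shows "dist_fun G \<phi> = (LINT x|lborel. complex_of_real (\<phi> x) * G x)"
  unfolding dist_fun_def by (rule integral_lborel[OF test_fn_times_integrable[OF assms]])

lemma LINT_test_fn_eq_integral: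
  assumes "test_fn \<phi>" "continuous_on UNIV G" and R: "\<And>x. R \<le> \<bar>x\<bar> \<Longrightarrow> \<phi> x = 0"
  shows "(LINT x|lborel. complex_of_real (\<phi> x) * G x) = integral {-R..R} (\<lambda>x. complex_of_real (\<phi> x) * G x)"
proof -
  have "(\<lambda>x. complex_of_real (\<phi> x) * G x) = (\<lambda>x. if x \<in> {-R..R} then complex_of_real (\<phi> x) * G x else 0)"
  proof
    show "complex_of_real (\<phi> x) * G x = (if x \<in> {-R..R} then complex_of_real (\<phi> x) * G x else 0)" for x
      using R[of x] by (cases "R \<le> \<bar>x\<bar>") auto
  qed
  then show ?thesis
    using integral_lborel[OF test_fn_times_integrable[OF assms(1,2)]]
      integral_restrict_UNIV[of "{-R..R}" "\<lambda>x. complex_of_real (\<phi> x) * G x"] by simp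
qed

lemma test_fn_by_parts:
  assumes \<phi>: "test_fn \<phi>" and w: "\<And>x. (w has_vector_derivative w' x) (at x)"
    and w': "continuous_on UNIV w'"
  shows "(LINT x|lborel. complex_of_real (deriv \<phi> x) * w x) = - (LINT x|lborel. complex_of_real (\<phi> x) * w' x)"
proof -
  obtain R where R: "R > 0" "\<And>x. R \<le> \<bar>x\<bar> \<Longrightarrow> \<phi> x = 0"
    using test_fn_support[OF \<phi>] by blast
  obtain S where S: "\<And>x. S \<le> \<bar>x\<bar> \<Longrightarrow> deriv \<phi> x = 0"
    using test_fn_support[OF test_fn_deriv[OF \<phi>]] by blast
  \<comment> \<open>Beyond \<open>T\<close> both \<open>\<phi>\<close> and its derivative vanish, so
    the boundary terms at \<open>T\<close> and \<open>-T\<close> are 0 and the integral over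
    \<open>{-T..T}\<close> is the integral over the line.\<close>
  define T where "T = max R S"
  have T: "\<phi> x = 0" "deriv \<phi> x = 0" if "T \<le> \<bar>x\<bar>" for x
    using R(2)[of x] S[of x] that by (auto simp: T_def)
  have "T > 0" using R(1) by (simp add: T_def)
  have cw: "continuous_on UNIV w"
    using w has_vector_derivative_continuous continuous_at_imp_continuous_on by blast
  let ?f = "\<lambda>x. complex_of_real (deriv \<phi> x) * w x + complex_of_real (\<phi> x) * w' x"
  have "(LINT x|lborel. indicator {-T..T} x *\<^sub>R ?f x)
      = complex_of_real (\<phi> T) * w T - complex_of_real (\<phi> (-T)) * w (-T)"
  proof (rule integral_FTC_atLeastAtMost)
    show "((\<lambda>x. complex_of_real (\<phi> x) * w x) has_vector_derivative ?f x) (at x within {-T..T})" for x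
    proof -
      have "(\<phi> has_real_derivative deriv \<phi> x) (at x)"
        using smooth_fn_has_derivative \<phi> by (simp add: test_fn_def)
      from has_vector_derivative_mult[OF has_vector_derivative_of_real[OF this] w]
      have "((\<lambda>x. complex_of_real (\<phi> x) * w x) has_vector_derivative ?f x) (at x)"
        by (simp add: add.commute)
      then show ?thesis by (rule has_vector_derivative_at_within)
    qed
    show "continuous_on {-T..T} ?f"
      by (intro continuous_intros test_fn_continuous \<phi> test_fn_deriv
          continuous_on_subset[OF cw] continuous_on_subset[OF w']) auto
  qed (use \<open>T > 0\<close> in simp)
  also have "\<dots> = 0" using T by simp
  also have "(\<lambda>x. indicator {-T..T} x *\<^sub>R ?f x) = ?f"
  proof
    show "indicator {-T..T} x *\<^sub>R ?f x = ?f x" for x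
      using T[of x] by (cases "T \<le> \<bar>x\<bar>") (auto simp: indicator_def)
  qed
  finally show ?thesis
    using test_fn_times_integrable[OF \<phi> w'] test_fn_times_integrable[OF test_fn_deriv[OF \<phi>] cw]
    by (simp add: eq_neg_iff_add_eq_0)
qed

lemma has_vector_derivative_cis:
  assumes "(f has_real_derivative f') (at x)"
  shows "((\<lambda>x. cis (f x)) has_vector_derivative \<i> * complex_of_real f' * cis (f x)) (at x)"
proof -
  have "((\<lambda>x. \<i> * complex_of_real (f x)) has_vector_derivative \<i> * complex_of_real f') (at x)"
    using assms by (intro has_vector_derivative_mult_right has_vector_derivative_of_real)
  from field_vector_diff_chain_at[OF this DERIV_exp] show ?thesis
    by (simp add: o_def cis_conv_exp)
qed

lemma continuous_on_cis_comp [continuous_intros]: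
  "continuous_on S f \<Longrightarrow> continuous_on S (\<lambda>x. cis (f x))"
  unfolding cis_conv_exp by (intro continuous_intros)

lemma measurable_cis [measurable]: "cis \<in> borel_measurable borel"
  by (intro borel_measurable_continuous_onI continuous_intros)

section \<open>The Fourier transform, its derivative and its decay\<close>

definition fourier :: "(real \<Rightarrow> real) \<Rightarrow> real \<Rightarrow> complex" where
  "fourier \<phi> t = (LINT s|lborel. complex_of_real (\<phi> s) * cis (- (s * t)))"

text \<open>Written through the transform of the real test function \<open>s * \<phi> s\<close>, so
  that continuity and decay of transforms apply to the derivative as well.\<close>

definition fourier_deriv :: "(real \<Rightarrow> real) \<Rightarrow> real \<Rightarrow> complex" where
  "fourier_deriv \<phi> t = - \<i> * fourier (\<lambda>s. s * \<phi> s) t"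

lemma test_fn_ident_mult: "test_fn \<phi> \<Longrightarrow> test_fn (\<lambda>s. s * \<phi> s)"
  by (rule test_fn_mult[OF smooth_fn_ident])

text \<open>Compact support reduces the transform to an integral over \<open>{-R..R}\<close>, where
  the Leibniz rule for parameter integrals applies.\<close>

lemma fourier_has_derivative:
  assumes \<phi>: "test_fn \<phi>"
  shows "(fourier \<phi> has_vector_derivative fourier_deriv \<phi> t) (at t)"
proof -
  obtain R where R: "R > 0" "\<And>x. R \<le> \<bar>x\<bar> \<Longrightarrow> \<phi> x = 0"
    using test_fn_support[OF \<phi>] by blast
  note [continuous_intros] = test_fn_continuous[OF \<phi>]
  have "((\<lambda>t. integral (cbox (-R) R) (\<lambda>s. complex_of_real (\<phi> s) * cis (- (s * t))))
     has_vector_derivative integral (cbox (-R) R) (\<lambda>s. complex_of_real (\<phi> s) * (\<i> * complex_of_real (- s) * cis (- (s * t))))) (at t within UNIV)"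
  proof (rule leibniz_rule_vector_derivative)
    show "((\<lambda>t. complex_of_real (\<phi> s) * cis (- (s * t))) has_vector_derivative
        complex_of_real (\<phi> s) * (\<i> * complex_of_real (- s) * cis (- (s * t)))) (at t within UNIV)" for s t
      by (intro has_vector_derivative_mult_right has_vector_derivative_cis)
        (auto intro!: derivative_eq_intros)
    show "(\<lambda>s. complex_of_real (\<phi> s) * cis (- (s * t))) integrable_on cbox (-R) R" for t
      by (intro integrable_continuous continuous_intros)
    show "continuous_on (UNIV \<times> cbox (-R) R)
        (\<lambda>(t, s). complex_of_real (\<phi> s) * (\<i> * complex_of_real (- s) * cis (- (s * t))))"
      unfolding split_beta
      by (intro continuous_intros continuous_on_compose2[OF test_fn_continuous[OF \<phi>, of UNIV]]) auto
  qed auto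
  moreover have "fourier \<phi> t = integral {-R..R} (\<lambda>s. complex_of_real (\<phi> s) * cis (- (s * t)))" for t
    unfolding fourier_def by (intro LINT_test_fn_eq_integral \<phi> continuous_intros R)
  moreover have "fourier_deriv \<phi> t = integral {-R..R} (\<lambda>s. complex_of_real (\<phi> s) * (\<i> * complex_of_real (- s) * cis (- (s * t))))"
  proof -
    have "fourier_deriv \<phi> t = (LINT s|lborel. - \<i> * (complex_of_real (s * \<phi> s) * cis (- (s * t))))"
      unfolding fourier_deriv_def fourier_def by simp
    also have "\<dots> = (LINT s|lborel. complex_of_real (\<phi> s) * (\<i> * complex_of_real (- s) * cis (- (s * t))))"
      by (rule Bochner_Integration.integral_cong) (auto simp: algebra_simps)
    also have "\<dots> = integral {-R..R} (\<lambda>s. complex_of_real (\<phi> s) * (\<i> * complex_of_real (- s) * cis (- (s * t))))"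
      by (intro LINT_test_fn_eq_integral \<phi> continuous_intros R)
    finally show ?thesis .
  qed
  moreover have "fourier \<phi> = (\<lambda>t. integral {-R..R} (\<lambda>s. complex_of_real (\<phi> s) * cis (- (s * t))))"
    using calculation(2) by (rule ext)
  ultimately show ?thesis by simp
qed

lemma fourier_continuous: "test_fn \<phi> \<Longrightarrow> continuous_on UNIV (fourier \<phi>)"
  using fourier_has_derivative has_vector_derivative_continuous continuous_at_imp_continuous_on by blast

lemma fourier_bound: "cmod (fourier \<phi> t) \<le> (LINT s|lborel. \<bar>\<phi> s\<bar>)"
proof -
  have "cmod (fourier \<phi> t) \<le> (LINT s|lborel. cmod (complex_of_real (\<phi> s) * cis (- (s * t))))"
    unfolding fourier_def by (rule integral_norm_bound)
  then show ?thesis by (simp add: norm_mult)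
qed

text \<open>Each integration by parts moves a derivative onto the exponential and yields a factor
  \<open>\<i> * t\<close>.\<close>

lemma fourier_deriv2:
  assumes \<phi>: "test_fn \<phi>" shows "fourier (deriv (deriv \<phi>)) t = - (complex_of_real (t\<^sup>2) * fourier \<phi> t)"
proof -
  have d: "((\<lambda>s. cis (- (s * t))) has_vector_derivative \<i> * complex_of_real (- t) * cis (- (s * t))) (at s)" for s
    by (intro has_vector_derivative_cis) (auto intro!: derivative_eq_intros)
  have step: "fourier (deriv \<phi>) t = \<i> * complex_of_real t * fourier \<phi> t" if "test_fn \<phi>" for \<phi>
  proof -
    have "fourier (deriv \<phi>) t = - (LINT s|lborel. complex_of_real (\<phi> s) * (\<i> * complex_of_real (- t) * cis (- (s * t))))"
      unfolding fourier_def by (rule test_fn_by_parts[OF that d]) (intro continuous_intros)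
    also have "(LINT s|lborel. complex_of_real (\<phi> s) * (\<i> * complex_of_real (- t) * cis (- (s * t))))
        = (LINT s|lborel. (- \<i> * complex_of_real t) * (complex_of_real (\<phi> s) * cis (- (s * t))))"
      by (rule Bochner_Integration.integral_cong) (auto simp: algebra_simps)
    finally show ?thesis by (simp add: fourier_def)
  qed
  show ?thesis unfolding step[OF test_fn_deriv[OF \<phi>]] step[OF \<phi>]
    by (simp add: power2_eq_square algebra_simps)
qed

text \<open>The transform is bounded by the L1 norm of \<open>\<phi>\<close>, and \<open>t^2\<close>
  times the transform by the L1 norm of the second derivative; the constant is their sum.\<close>

lemma fourier_decay:
  assumes \<phi>: "test_fn \<phi>" shows "\<exists>C. \<forall>t. cmod (fourier \<phi> t) \<le> C / (1 + t\<^sup>2)"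
proof (intro exI allI)
  fix t
  have "t\<^sup>2 * cmod (fourier \<phi> t) = cmod (fourier (deriv (deriv \<phi>)) t)"
    unfolding fourier_deriv2[OF \<phi>] by (simp add: norm_mult norm_power)
  then have "(1 + t\<^sup>2) * cmod (fourier \<phi> t) \<le> (LINT s|lborel. \<bar>\<phi> s\<bar>) + (LINT s|lborel. \<bar>deriv (deriv \<phi>) s\<bar>)"
    using fourier_bound[of \<phi> t] fourier_bound[of "deriv (deriv \<phi>)" t]
    by (simp add: algebra_simps)
  then show "cmod (fourier \<phi> t) \<le> ((LINT s|lborel. \<bar>\<phi> s\<bar>) + (LINT s|lborel. \<bar>deriv (deriv \<phi>) s\<bar>)) / (1 + t\<^sup>2)"
    by (simp add: pos_le_divide_eq one_plus_sq_pos mult.commute)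
qed

lemma fourier_kernel:
  assumes \<phi>: "test_fn \<phi>" obtains C where "decaying_kernel (fourier \<phi>) (fourier_deriv \<phi>) C"
proof -
  obtain A B where A: "\<And>t. cmod (fourier \<phi> t) \<le> A / (1 + t\<^sup>2)"
    and B: "\<And>t. cmod (fourier (\<lambda>s. s * \<phi> s) t) \<le> B / (1 + t\<^sup>2)"
    using fourier_decay \<phi> test_fn_ident_mult by metis
  have "decaying_kernel (fourier \<phi>) (fourier_deriv \<phi>) (max A B)"
  proof
    show "continuous_on UNIV (fourier_deriv \<phi>)"
      unfolding fourier_deriv_def by (intro continuous_intros fourier_continuous test_fn_ident_mult \<phi>)
    show "cmod (fourier \<phi> t) \<le> max A B / (1 + t\<^sup>2)" for t
      by (rule order_trans[OF A]) (intro divide_right_mono, auto)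
    show "cmod (fourier_deriv \<phi> t) \<le> max A B / (1 + t\<^sup>2)" for t
      unfolding fourier_deriv_def norm_mult
      by (simp, rule order_trans[OF B]) (intro divide_right_mono, auto)
  qed (rule fourier_has_derivative[OF \<phi>])
  then show ?thesis by (rule that)
qed

lemma fourier_integrable: "test_fn \<phi> \<Longrightarrow> integrable lborel (fourier \<phi>)"
proof -
  assume \<phi>: "test_fn \<phi>"
  then obtain C where C: "\<And>t. cmod (fourier \<phi> t) \<le> C / (1 + t\<^sup>2)" using fourier_decay by blast
  have "integrable lborel (\<lambda>t. 1 * fourier \<phi> t)"
    by (rule integrable_bounded_times_decay[where B = 1, OF _ _ _ C])
      (auto intro: borel_measurable_continuous_onI fourier_continuous[OF \<phi>])
  then show ?thesis by simp
qed

lemma bump_mass: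
  assumes \<psi>: "test_fn \<psi>" and "\<And>x. \<psi> x \<ge> 0" "\<psi> 0 > 0"
  shows "(LINT s|lborel. \<psi> s) \<noteq> 0"
  using continuous_nonneg_LINT_eq_0[of \<psi> 0] test_fn_integrable[OF \<psi>, of "\<lambda>_. 1::real"]
    test_fn_continuous[OF \<psi>] assms by auto

text \<open>If all the integrals vanished, Fubini would give \<open>\<integral>|fourier \<psi>|\<^sup>2 = 0\<close> for a bump \<open>\<psi>\<close>,
  because translating \<open>\<psi>\<close> modulates its transform.\<close>
lemma fourier_mass_exists: "\<exists>\<psi>. test_fn \<psi> \<and> (LINT t|lborel. fourier \<psi> t) \<noteq> 0"
proof (rule ccontr)
  assume "\<not> ?thesis"
  then have zero: "(LINT t|lborel. fourier \<psi> t) = 0" if "test_fn \<psi>" for \<psi> using that by blast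
  obtain \<psi> where \<psi>: "test_fn \<psi>" and pos: "\<And>x. \<psi> x \<ge> 0" "\<psi> 0 > 0" using bump_exists by blast
  note [measurable] = test_fn_measurable[OF \<psi>]
  have [measurable]: "fourier \<psi> \<in> borel_measurable borel"
    by (intro borel_measurable_continuous_onI fourier_continuous \<psi>)
  \<comment> \<open>The translate of \<open>\<psi>\<close> by \<open>b\<close> is again a test
    function, and its transform is that of \<open>\<psi>\<close> times
    \<open>cis (b * t)\<close>.\<close>
  have modulated: "(LINT t|lborel. fourier \<psi> t * cis (b * t)) = 0" for b
  proof -
    have "fourier (\<lambda>s. \<psi> (b + 1 * s)) t = fourier \<psi> t * cis (b * t)" for t
    proof -
      have "fourier \<psi> t = (LINT s|lborel. complex_of_real (\<psi> (b + 1 * s)) * cis (- ((b + 1 * s) * t)))"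
        unfolding fourier_def by (subst lborel_integral_real_affine[of 1 _ b]) auto
      also have "\<dots> = (LINT s|lborel. (complex_of_real (\<psi> (b + 1 * s)) * cis (- (s * t))) * cis (- (b * t)))"
        by (rule Bochner_Integration.integral_cong) (auto simp: cis_mult algebra_simps)
      also have "\<dots> = fourier (\<lambda>s. \<psi> (b + 1 * s)) t * cis (- (b * t))"
        unfolding fourier_def by (rule integral_mult_left_zero)
      finally show ?thesis by (simp add: mult.assoc cis_mult)
    qed
    then show ?thesis using zero[OF test_fn_affine[OF \<psi>, of 1 b]] by simp
  qed
  \<comment> \<open>Weighting with \<open>\<psi> b\<close> and integrating over \<open>b\<close>
    turns the modulation \<open>cis (b * t)\<close> into the conjugate of
    \<open>fourier \<psi> t\<close>, since \<open>\<psi>\<close> is real.\<close>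
  define f where "f t b = complex_of_real (\<psi> b) * (fourier \<psi> t * cis (b * t))" for t b
  have "integrable (lborel \<Otimes>\<^sub>M lborel) (case_prod f)"
  proof (rule integrable_pair_dominated)
    show "case_prod f \<in> borel_measurable (lborel \<Otimes>\<^sub>M lborel)" unfolding f_def by measurable
    show "integrable lborel (\<lambda>t. cmod (fourier \<psi> t))" using fourier_integrable[OF \<psi>] by simp
    show "integrable lborel \<psi>" using test_fn_integrable[OF \<psi>, of "\<lambda>_. 1::real"] by simp
    show "cmod (f t b) \<le> cmod (fourier \<psi> t) * \<psi> b" for t b
      using pos by (simp add: f_def norm_mult)
  qed
  then have "(LINT b|lborel. LINT t|lborel. f t b) = (LINT t|lborel. LINT b|lborel. f t b)"
    by (rule lborel_pair.Fubini_integral)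
  moreover have "(LINT t|lborel. f t b) = 0" for b
    unfolding f_def using modulated by simp
  moreover have "(LINT b|lborel. f t b) = complex_of_real ((cmod (fourier \<psi> t))\<^sup>2)" for t
  proof -
    have "(LINT b|lborel. f t b) = (LINT b|lborel. fourier \<psi> t * cnj (complex_of_real (\<psi> b) * cis (- (b * t))))"
      unfolding f_def by (rule Bochner_Integration.integral_cong) (auto simp: cis_cnj)
    also have "\<dots> = fourier \<psi> t * cnj (fourier \<psi> t)"
    proof -
      have "(LINT b|lborel. cnj (complex_of_real (\<psi> b) * cis (- (b * t)))) = cnj (fourier \<psi> t)"
        unfolding fourier_def
        by (intro integral_bounded_linear bounded_linear_cnj test_fn_times_integrable \<psi> continuous_intros)
      then show ?thesis by (simp only: integral_mult_right_zero)
    qed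
    finally show ?thesis by (simp only: complex_norm_square)
  qed
  ultimately have "(LINT t|lborel. complex_of_real ((cmod (fourier \<psi> t))\<^sup>2)) = 0"
    by (simp only: Bochner_Integration.integral_zero)
  then have L2: "(LINT t|lborel. (cmod (fourier \<psi> t))\<^sup>2) = 0"
    unfolding integral_complex_of_real by simp
  obtain C where C: "\<And>t. cmod (fourier \<psi> t) \<le> C / (1 + t\<^sup>2)" using fourier_decay[OF \<psi>] by blast
  have "integrable lborel (\<lambda>t. cnj (fourier \<psi> t) * fourier \<psi> t)"
    by (rule integrable_bounded_times_decay[OF _ _ _ C])
      (auto intro: fourier_bound
        intro!: borel_measurable_continuous_onI continuous_intros fourier_continuous[OF \<psi>])
  from integrable_norm[OF this] have "integrable lborel (\<lambda>t. (cmod (fourier \<psi> t))\<^sup>2)"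
    by (simp add: norm_mult power2_eq_square)
  \<comment> \<open>The value at 0 is the integral of the bump itself, which is nonzero.\<close>
  then have "(cmod (fourier \<psi> 0))\<^sup>2 = 0"
    by (rule continuous_nonneg_LINT_eq_0[rotated 2, OF _ L2])
      (auto intro!: continuous_intros fourier_continuous[OF \<psi>])
  then have "(LINT s|lborel. complex_of_real (\<psi> s)) = 0" by (simp add: fourier_def)
  then have "(LINT s|lborel. \<psi> s) = 0" by simp
  with pos show False using bump_mass[OF \<psi>] by fastforce
qed

lemma test_fn_kernel:
  assumes \<psi>: "test_fn \<psi>"
  obtains C where "decaying_kernel (\<lambda>x. complex_of_real (\<psi> x)) (\<lambda>x. complex_of_real (deriv \<psi> x)) C"
proof -
  have "\<exists>C. \<forall>x. cmod (complex_of_real (\<phi> x)) \<le> C / (1 + x\<^sup>2)" if \<phi>: "test_fn \<phi>" for \<phi>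
  proof -
    obtain R where R: "R > 0" "\<And>x. R \<le> \<bar>x\<bar> \<Longrightarrow> \<phi> x = 0"
      using test_fn_support[OF \<phi>] by blast
    have "compact ((\<lambda>x. \<bar>\<phi> x\<bar> * (1 + x\<^sup>2)) ` {-R..R})"
      by (intro compact_continuous_image continuous_intros test_fn_continuous \<phi>) auto
    then have "bounded ((\<lambda>x. \<bar>\<phi> x\<bar> * (1 + x\<^sup>2)) ` {-R..R})" by (rule compact_imp_bounded)
    then obtain C where C: "\<And>x. x \<in> {-R..R} \<Longrightarrow> \<bar>\<bar>\<phi> x\<bar> * (1 + x\<^sup>2)\<bar> \<le> C"
      unfolding bounded_iff by (metis imageI real_norm_def)
    have "\<bar>\<phi> x\<bar> * (1 + x\<^sup>2) \<le> C" for x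
    proof (cases "R \<le> \<bar>x\<bar>")
      case True
      \<comment> \<open>Here \<open>\<phi> x = 0\<close>; the bound at 0 serves only to show that
        \<open>C\<close> is nonnegative.\<close>
      then show ?thesis using C[of 0] R by auto
    next
      case False
      then have "x \<in> {-R..R}" by auto
      then show ?thesis using C by fastforce
    qed
    then show ?thesis by (intro exI[of _ C]) (simp add: pos_le_divide_eq one_plus_sq_pos)
  qed
  then obtain A B where A: "\<And>x. cmod (complex_of_real (\<psi> x)) \<le> A / (1 + x\<^sup>2)"
    and B: "\<And>x. cmod (complex_of_real (deriv \<psi> x)) \<le> B / (1 + x\<^sup>2)"
    using \<psi> test_fn_deriv by metis
  have "decaying_kernel (\<lambda>x. complex_of_real (\<psi> x)) (\<lambda>x. complex_of_real (deriv \<psi> x)) (max A B)"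
  proof
    show "continuous_on UNIV (\<lambda>x. complex_of_real (deriv \<psi> x))"
      by (intro continuous_intros test_fn_continuous test_fn_deriv \<psi>)
    show "cmod (complex_of_real (\<psi> x)) \<le> max A B / (1 + x\<^sup>2)" for x
      by (rule order_trans[OF A]) (intro divide_right_mono, auto)
    show "cmod (complex_of_real (deriv \<psi> x)) \<le> max A B / (1 + x\<^sup>2)" for x
      by (rule order_trans[OF B]) (intro divide_right_mono, auto)
    show "((\<lambda>x. complex_of_real (\<psi> x)) has_vector_derivative complex_of_real (deriv \<psi> x)) (at x)" for x
      using smooth_fn_has_derivative \<psi>
      by (intro has_vector_derivative_of_real) (simp add: test_fn_def)
  qed
  then show ?thesis by (rule that)
qed

section \<open>Primitives and the transform\<close>

text \<open>The parametrization of \<open>Ac\<close> by primitives, through which all the spaces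
  become images of \<open>Bc\<close>.\<close>

definition bc_deriv :: "(real \<Rightarrow> complex) \<Rightarrow> distr" where
  "bc_deriv F = distr_of (dderiv (dist_fun F))"

lemma bc_deriv_apply:
  assumes "F \<in> Bc" "test_fn \<phi>"
  shows "bc_deriv F \<phi> = - (LINT x|lborel. complex_of_real (deriv \<phi> x) * F x)"
  using assms dist_fun_eq_LINT[OF test_fn_deriv[OF assms(2)]]
  by (simp add: bc_deriv_def distr_of_def dderiv_def Bc_iff)

lemma bc_deriv_not_test_fn: "\<not> test_fn \<phi> \<Longrightarrow> bc_deriv F \<phi> = 0"
  by (simp add: bc_deriv_def distr_of_def)

lemma Bc_test_integrable:
  "F \<in> Bc \<Longrightarrow> test_fn \<phi> \<Longrightarrow> integrable lborel (\<lambda>x. complex_of_real (deriv \<phi> x) * F x)"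
  by (intro test_fn_times_integrable test_fn_deriv) (auto simp: Bc_iff)

lemma bc_deriv_add:
  assumes F: "F \<in> Bc" and G: "G \<in> Bc"
  shows "bc_deriv (\<lambda>x. F x + G x) = (\<lambda>\<phi>. bc_deriv F \<phi> + bc_deriv G \<phi>)"
proof
  fix \<phi>
  show "bc_deriv (\<lambda>x. F x + G x) \<phi> = bc_deriv F \<phi> + bc_deriv G \<phi>"
  proof (cases "test_fn \<phi>")
    case True
    with Bc_test_integrable[OF F True] Bc_test_integrable[OF G True] show ?thesis
      by (simp add: bc_deriv_apply F G Bc_add distrib_left)
  qed (simp add: bc_deriv_not_test_fn)
qed

lemma bc_deriv_scale:
  assumes F: "F \<in> Bc"
  shows "bc_deriv (\<lambda>x. c * F x) = (\<lambda>\<phi>. c * bc_deriv F \<phi>)"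
proof
  fix \<phi>
  show "bc_deriv (\<lambda>x. c * F x) \<phi> = c * bc_deriv F \<phi>"
  proof (cases "test_fn \<phi>")
    case True
    have "(\<lambda>x. complex_of_real (deriv \<phi> x) * (c * F x)) = (\<lambda>x. c * (complex_of_real (deriv \<phi> x) * F x))"
      by (simp add: mult_ac)
    with True show ?thesis by (simp add: bc_deriv_apply F Bc_scale)
  qed (simp add: bc_deriv_not_test_fn)
qed

text \<open>Translates and dilates of a bump are test functions, and their derivatives are the
  rescaled derivative of the bump up to a factor. Hence the approximate identity argument applies
  with the bump as kernel.\<close>

lemma Bc_eq_zero_if_deriv_zero:
  assumes F: "F \<in> Bc" and zero: "\<And>\<phi>. test_fn \<phi> \<Longrightarrow> bc_deriv F \<phi> = 0"
  shows "F = (\<lambda>x. 0)"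
proof -
  obtain \<psi> where \<psi>: "test_fn \<psi>" and pos: "\<And>x. \<psi> x \<ge> 0" "\<psi> 0 > 0" using bump_exists by blast
  obtain C where C: "decaying_kernel (\<lambda>x. complex_of_real (\<psi> x)) (\<lambda>x. complex_of_real (deriv \<psi> x)) C"
    using test_fn_kernel[OF \<psi>] by blast
  show ?thesis
  proof (rule decaying_kernel.eq_zero_if_correlations_zero[OF C F])
    show "(LINT x|lborel. complex_of_real (\<psi> x)) \<noteq> 0"
      using bump_mass[OF \<psi> pos] by simp
    fix a \<epsilon> :: real assume \<epsilon>: "\<epsilon> > 0"
    define \<phi> where "\<phi> x = \<psi> (- a / \<epsilon> + (1 / \<epsilon>) * x)" for x
    have \<phi>: "test_fn \<phi>" unfolding \<phi>_def using \<epsilon> by (intro test_fn_affine[OF \<psi>]) auto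
    have "(\<phi> has_real_derivative deriv \<psi> (- a / \<epsilon> + (1 / \<epsilon>) * x) * (1 / \<epsilon>)) (at x)" for x
      unfolding \<phi>_def using \<psi> \<epsilon>
      by (intro DERIV_chain2[OF smooth_fn_has_derivative])
        (auto simp: test_fn_def intro!: derivative_eq_intros)
    then have "deriv \<phi> x = deriv \<psi> ((x - a) / \<epsilon>) / \<epsilon>" for x
      by (simp add: DERIV_imp_deriv diff_divide_distrib)
    then have "bc_deriv F \<phi> = - (LINT x|lborel. (1 / complex_of_real \<epsilon>) * (F x * complex_of_real (deriv \<psi> ((x - a) / \<epsilon>))))"
      unfolding bc_deriv_apply[OF F \<phi>] by (simp add: mult_ac)
    then have "bc_deriv F \<phi> = - ((1 / complex_of_real \<epsilon>) * (LINT x|lborel. F x * complex_of_real (deriv \<psi> ((x - a) / \<epsilon>))))"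
      by (simp only: integral_mult_right_zero)
    then show "(LINT x|lborel. F x * complex_of_real (deriv \<psi> ((x - a) / \<epsilon>))) = 0"
      using zero[OF \<phi>] \<epsilon> by simp
  qed
qed

lemma inj_on_linear_Bc:
  fixes \<Phi> :: "(real \<Rightarrow> complex) \<Rightarrow> 'b \<Rightarrow> complex"
  assumes add: "\<And>F G. F \<in> Bc \<Longrightarrow> G \<in> Bc \<Longrightarrow> \<Phi> (\<lambda>x. F x + G x) = (\<lambda>y. \<Phi> F y + \<Phi> G y)"
    and scale: "\<And>c F. F \<in> Bc \<Longrightarrow> \<Phi> (\<lambda>x. c * F x) = (\<lambda>y. c * \<Phi> F y)"
    and ker: "\<And>F. F \<in> Bc \<Longrightarrow> \<Phi> F = (\<lambda>y. 0) \<Longrightarrow> F = (\<lambda>x. 0)"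
  shows "inj_on \<Phi> Bc"
proof (rule inj_onI)
  fix F G assume F: "F \<in> Bc" and G: "G \<in> Bc" and eq: "\<Phi> F = \<Phi> G"
  have "\<Phi> (\<lambda>x. F x + (-1) * G x) = (\<lambda>y. 0)"
    unfolding add[OF F Bc_scale[OF G]] scale[OF G] eq by simp
  then have "(\<lambda>x. F x + (-1) * G x) = (\<lambda>x. 0)"
    by (rule ker[OF Bc_add[OF F Bc_scale[OF G]]])
  then show "F = G" by (simp add: fun_eq_iff)
qed

lemma inj_on_bc_deriv: "inj_on bc_deriv Bc"
  by (rule inj_on_linear_Bc[OF bc_deriv_add bc_deriv_scale Bc_eq_zero_if_deriv_zero]) auto

lemma Ac_eq: "Ac = bc_deriv ` Bc"
  by (auto simp: Ac_def bc_deriv_def)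

text \<open>Injectivity of differentiation on \<open>Bc\<close> makes the definite description in
  \<open>prim\<close> denote the expected primitive.\<close>

lemma prim_bc_deriv: "F \<in> Bc \<Longrightarrow> prim (bc_deriv F) = F"
  unfolding prim_def bc_deriv_def[symmetric]
  by (rule the_equality) (use inj_on_bc_deriv in \<open>auto dest: inj_onD\<close>)

text \<open>\<open>vkern (s * t) / t ^ 3\<close> is the \<open>t\<close>-derivative of \<open>vfun s t\<close>.\<close>
definition vkern :: "real \<Rightarrow> complex" where
  "vkern x = \<i> * x + \<i> * x * cis (- x) - 2 + 2 * cis (- x)"

section \<open>Size and derivatives of the integral kernel\<close>

lemma has_vector_derivative_cis_minus:
  "((\<lambda>x. cis (- x)) has_vector_derivative - \<i> * cis (- x)) (at x)"
  using has_vector_derivative_cis[OF DERIV_minus[OF DERIV_ident]] by simp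

lemma has_vector_derivative_ident_complex:
  "(complex_of_real has_vector_derivative 1) (at x)"
  using has_vector_derivative_of_real[of "\<lambda>x. x" 1 "at x"] by simp

text \<open>This derivative and \<open>vkern\<close> both vanish at 0. The formula serves the cubic
  bound near 0 and also the integration by parts in \<open>s\<close>.\<close>

lemma vkern_deriv: "(vkern has_vector_derivative \<i> - \<i> * cis (- x) + x * cis (- x)) (at x)"
  unfolding vkern_def
  by (rule derivative_eq_intros has_vector_derivative_cis_minus has_vector_derivative_ident_complex refl)+
    (simp add: algebra_simps)

lemma vkern_deriv2:
  "((\<lambda>x. \<i> - \<i> * cis (- x) + x * cis (- x)) has_vector_derivative - \<i> * x * cis (- x)) (at x)"
  by (rule derivative_eq_intros has_vector_derivative_cis_minus has_vector_derivative_ident_complex refl)+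
    (simp add: algebra_simps)

text \<open>The mean value inequality on the symmetric interval of radius \<open>|x|\<close>, which
  avoids distinguishing the sign of \<open>x\<close>.\<close>

lemma norm_diff_le_of_vector_derivative:
  fixes f :: "real \<Rightarrow> 'a::real_normed_vector"
  assumes "\<And>y. (f has_vector_derivative f' y) (at y)" and "\<And>y. \<bar>y\<bar> \<le> \<bar>x\<bar> \<Longrightarrow> norm (f' y) \<le> B"
  shows "norm (f x - f 0) \<le> B * \<bar>x\<bar>"
proof -
  have "norm (f x - f 0) \<le> B * norm (x - 0)"
  proof (rule differentiable_bound[of "{-\<bar>x\<bar>..\<bar>x\<bar>}" f "\<lambda>y h. h *\<^sub>R f' y"])
    show "(f has_derivative (\<lambda>h. h *\<^sub>R f' y)) (at y within {-\<bar>x\<bar>..\<bar>x\<bar>})" for y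
      using has_vector_derivative_at_within[OF assms(1)] by (simp add: has_vector_derivative_def)
    show "onorm (\<lambda>h. h *\<^sub>R f' y) \<le> B" if "y \<in> {-\<bar>x\<bar>..\<bar>x\<bar>}" for y
    proof (rule onorm_le)
      have "norm (f' y) \<le> B" using that by (intro assms(2)) auto
      then show "norm (h *\<^sub>R f' y) \<le> B * norm h" for h
        using mult_right_mono[of "norm (f' y)" B "\<bar>h\<bar>"] by (simp add: mult.commute)
    qed
  qed auto
  then show ?thesis by simp
qed

text \<open>For \<open>|y| \<le> |x|\<close> the second derivative is at most \<open>|x|\<close>.
  Two applications of the mean value inequality, starting from zero values at 0, raise this to
  \<open>|x|^2\<close> and then \<open>|x|^3\<close>.\<close>

lemma vkern_le_cube: "cmod (vkern x) \<le> \<bar>x\<bar> ^ 3"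
proof -
  have "cmod (\<i> - \<i> * cis (- y) + y * cis (- y)) \<le> \<bar>x\<bar>\<^sup>2" if "\<bar>y\<bar> \<le> \<bar>x\<bar>" for y
  proof -
    have "cmod ((\<i> - \<i> * cis (- y) + y * cis (- y)) - (\<i> - \<i> * cis (- 0) + complex_of_real 0 * cis (- 0))) \<le> \<bar>x\<bar> * \<bar>y\<bar>"
      by (rule norm_diff_le_of_vector_derivative[OF vkern_deriv2]) (use that in \<open>simp add: norm_mult\<close>)
    also have "\<dots> \<le> \<bar>x\<bar> * \<bar>x\<bar>" using that by (intro mult_left_mono) auto
    finally show ?thesis by (simp add: power2_eq_square)
  qed
  then have "cmod (vkern x - vkern 0) \<le> \<bar>x\<bar>\<^sup>2 * \<bar>x\<bar>"
    by (rule norm_diff_le_of_vector_derivative[OF vkern_deriv])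
  then show ?thesis by (simp add: vkern_def power2_eq_square power3_eq_cube)
qed

lemma vkern_le_linear: "cmod (vkern x) \<le> 2 * \<bar>x\<bar> + 4"
proof -
  have "cmod (vkern x) \<le> cmod (\<i> * x) + cmod (\<i> * x * cis (- x)) + cmod 2 + cmod (2 * cis (- x))"
    unfolding vkern_def by (smt (verit) norm_triangle_ineq norm_triangle_ineq4)
  then show ?thesis by (simp add: norm_mult)
qed

text \<open>Division by zero gives the value 0 at \<open>t = 0\<close>. It is not claimed to be a
  derivative there, and a single point does not affect the integrals.\<close>

definition vderiv :: "real \<Rightarrow> real \<Rightarrow> complex" where
  "vderiv s t = vkern (s * t) / complex_of_real t ^ 3"

text \<open>For \<open>|t| \<le> 1\<close> the cubic bound on \<open>vkern\<close> cancels
  \<open>t^3\<close>; for larger \<open>|t|\<close> the linear bound leaves \<open>1 / t^2\<close>.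
  The factor 2 compares \<open>1 + t^2\<close> with 1 and with \<open>t^2\<close>
  respectively.\<close>

lemma vderiv_bound:
  "cmod (vderiv s t) \<le> 2 * (\<bar>s\<bar> ^ 3 + 2 * \<bar>s\<bar> + 4) / (1 + t\<^sup>2)"
proof (cases "\<bar>t\<bar> \<le> 1")
  case True
  have t2: "1 + t\<^sup>2 \<le> 2" using True by (simp add: abs_square_le_1)
  have "cmod (vderiv s t) \<le> \<bar>s\<bar> ^ 3"
  proof (cases "t = 0")
    case False
    then show ?thesis using vkern_le_cube[of "s * t"]
      by (simp add: vderiv_def norm_divide norm_power abs_mult power_mult_distrib pos_divide_le_eq)
  qed (simp add: vderiv_def)
  then have "cmod (vderiv s t) * (1 + t\<^sup>2) \<le> (\<bar>s\<bar> ^ 3) * 2"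
    using t2 by (intro mult_mono) auto
  also have "\<dots> \<le> 2 * (\<bar>s\<bar> ^ 3 + 2 * \<bar>s\<bar> + 4)" by simp
  finally show ?thesis by (simp add: pos_le_divide_eq one_plus_sq_pos)
next
  case False
  then have t: "\<bar>t\<bar> > 1" by simp
  then have t2: "1 + t\<^sup>2 \<le> 2 * t\<^sup>2" using one_le_power[of "\<bar>t\<bar>" 2] by simp
  have "cmod (vderiv s t) * \<bar>t\<bar> ^ 3 = cmod (vkern (s * t))"
    using t by (simp add: vderiv_def norm_divide norm_power)
  also have "\<dots> \<le> 2 * \<bar>s * t\<bar> + 4" by (rule vkern_le_linear)
  also have "\<dots> \<le> (2 * \<bar>s\<bar> + 4) * \<bar>t\<bar>" using t by (simp add: abs_mult algebra_simps)
  finally have "(cmod (vderiv s t) * t\<^sup>2) * \<bar>t\<bar> \<le> (2 * \<bar>s\<bar> + 4) * \<bar>t\<bar>"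
    by (simp add: power3_eq_cube power2_eq_square mult.assoc)
  then have "cmod (vderiv s t) * t\<^sup>2 \<le> 2 * \<bar>s\<bar> + 4"
    by (rule mult_right_le_imp_le) (use t in simp)
  moreover have "cmod (vderiv s t) * (1 + t\<^sup>2) \<le> cmod (vderiv s t) * (2 * t\<^sup>2)"
    using t2 by (intro mult_left_mono) auto
  ultimately have "cmod (vderiv s t) * (1 + t\<^sup>2) \<le> 2 * (2 * \<bar>s\<bar> + 4)" by simp
  also have "\<dots> \<le> 2 * (\<bar>s\<bar> ^ 3 + 2 * \<bar>s\<bar> + 4)" by simp
  finally show ?thesis by (simp add: pos_le_divide_eq one_plus_sq_pos)
qed

lemma vfun_has_derivative:
  assumes t: "t \<noteq> 0" shows "(vfun s has_vector_derivative vderiv s t) (at t)"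
proof -
  have inv: "((\<lambda>t. complex_of_real (1 / t\<^sup>2)) has_vector_derivative complex_of_real (- 2 / t ^ 3)) (at t)"
    using t by (intro has_vector_derivative_of_real)
      (auto intro!: derivative_eq_intros simp: power2_eq_square power3_eq_cube field_simps)
  have lin: "((\<lambda>t. complex_of_real (s * t)) has_vector_derivative complex_of_real s) (at t)"
    by (intro has_vector_derivative_of_real) (auto intro!: derivative_eq_intros)
  have cs: "((\<lambda>t. cis (- (s * t))) has_vector_derivative \<i> * complex_of_real (- s) * cis (- (s * t))) (at t)"
    by (intro has_vector_derivative_cis) (auto intro!: derivative_eq_intros)
  have "((\<lambda>t. 1 - \<i> * complex_of_real (s * t) - cis (- (s * t))) has_vector_derivative
      0 - \<i> * complex_of_real s - \<i> * complex_of_real (- s) * cis (- (s * t))) (at t)"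
    by (intro has_vector_derivative_diff has_vector_derivative_const has_vector_derivative_mult_right lin cs)
  from has_vector_derivative_mult[OF this inv]
  have "((\<lambda>t. (1 - \<i> * complex_of_real (s * t) - cis (- (s * t))) * complex_of_real (1 / t\<^sup>2))
      has_vector_derivative vderiv s t) (at t)"
    by (rule has_vector_derivative_eq_rhs)
      (use t in \<open>simp add: vderiv_def vkern_def field_simps power2_eq_square power3_eq_cube\<close>)
  then show ?thesis
    by (rule has_vector_derivative_transform_within_open[where S = "- {0}"])
      (use t in \<open>auto simp: vfun_def cis_conv_exp\<close>)
qed

text \<open>The numerator grows at most linearly. This removes the boundary term at infinity from
  \<open>pairing\<close>.\<close>

lemma vfun_tendsto_0: "(vfun s \<longlongrightarrow> 0) at_top"
proof (rule Lim_null_comparison)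
  show "\<forall>\<^sub>F t in at_top. norm (vfun s t) \<le> (2 + \<bar>s\<bar> * t) / t\<^sup>2"
    using eventually_gt_at_top[of 0]
  proof eventually_elim
    case (elim t)
    have "cmod (1 - \<i> * complex_of_real (s * t) - cis (- (s * t))) \<le> cmod 1 + cmod (\<i> * complex_of_real (s * t)) + cmod (cis (- (s * t)))"
      by (smt (verit) norm_triangle_ineq4)
    also have "\<dots> = 2 + \<bar>s\<bar> * t" using elim by (simp add: norm_mult abs_mult)
    finally show ?case using elim
      by (simp add: vfun_def cis_conv_exp norm_divide divide_right_mono norm_power)
  qed
  show "((\<lambda>t. (2 + \<bar>s\<bar> * t) / t\<^sup>2) \<longlongrightarrow> 0) at_top" by real_asymp
qed

lemma vkern_continuous [continuous_intros]:
  "continuous_on S f \<Longrightarrow> continuous_on S (\<lambda>x. vkern (f x))"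
  unfolding vkern_def by (intro continuous_intros)

lemma vkern_measurable [measurable]: "vkern \<in> borel_measurable borel"
  by (intro borel_measurable_continuous_onI continuous_intros)

section \<open>The transform and its second derivative in terms of the primitive\<close>

lemma Bc_vderiv_integrable:
  assumes F: "F \<in> Bc" shows "integrable lborel (\<lambda>t. F t * vderiv s t)"
proof -
  note [measurable] = Bc_measurable[OF F]
  have [measurable]: "vderiv s \<in> borel_measurable borel" unfolding vderiv_def by measurable
  show ?thesis
    by (rule integrable_bounded_times_decay[OF _ _ Bc_le_supnorm[OF F] vderiv_bound]) measurable
qed

text \<open>The boundary term of the pairing vanishes, \<open>vderiv\<close> replaces the derivative
  of \<open>vfun\<close> off the null set \<open>{0}\<close>, and integrability turns the gauge
  integral into a Lebesgue integral.\<close>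

lemma Omega_bc_deriv:
  assumes F: "F \<in> Bc"
  shows "Omega (bc_deriv F) = (\<lambda>s. - (LINT t|lborel. F t * vderiv s t))"
proof
  fix s
  have "Lim at_top (vfun s) = 0" by (rule tendsto_Lim[OF _ vfun_tendsto_0]) simp
  moreover have "integral UNIV (\<lambda>t. F t * vector_derivative (vfun s) (at t)) = integral UNIV (\<lambda>t. F t * vderiv s t)"
    by (rule integral_spike[of "{0}"]) (auto simp: vector_derivative_at[OF vfun_has_derivative])
  moreover have "integral UNIV (\<lambda>t. F t * vderiv s t) = (LINT t|lborel. F t * vderiv s t)"
    by (rule integral_lborel[OF Bc_vderiv_integrable[OF F]])
  ultimately show "Omega (bc_deriv F) s = - (LINT t|lborel. F t * vderiv s t)"
    by (simp add: Omega_def pairing_def prim_bc_deriv[OF F])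
qed

text \<open>Integrating by parts twice in \<open>s\<close>: the second \<open>s\<close>-derivative of \<open>vfun s t\<close> is \<open>exp (- \<i> * s * t)\<close>.\<close>
lemma LINT_deriv2_vderiv:
  assumes \<phi>: "test_fn \<phi>" and t: "t \<noteq> 0"
  shows "(LINT s|lborel. complex_of_real (deriv (deriv \<phi>) s) * vderiv s t) = fourier_deriv \<phi> t"
proof -
  \<comment> \<open>The first \<open>s\<close>-derivative of \<open>vderiv s t\<close>.\<close>
  let ?v1 = "\<lambda>s. (\<i> - \<i> * cis (- (s * t)) + complex_of_real (s * t) * cis (- (s * t))) / complex_of_real t ^ 2"
  have lin: "((\<lambda>s. s * t) has_vector_derivative t) (at s)" for s
    by (auto intro!: derivative_eq_intros)
  have d1: "((\<lambda>s. vderiv s t) has_vector_derivative ?v1 s) (at s)" for s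
  proof -
    have "((\<lambda>s. vkern (s * t)) has_vector_derivative
        t *\<^sub>R (\<i> - \<i> * cis (- (s * t)) + complex_of_real (s * t) * cis (- (s * t)))) (at s)"
      using vector_diff_chain_at[OF lin vkern_deriv] by (simp add: o_def)
    from has_vector_derivative_divide[OF this, of "complex_of_real t ^ 3"] show ?thesis
      unfolding vderiv_def
      by (rule has_vector_derivative_eq_rhs)
        (use t in \<open>simp add: scaleR_conv_of_real power2_eq_square power3_eq_cube\<close>)
  qed
  \<comment> \<open>The powers of \<open>t\<close> cancel; the result is the
    \<open>t\<close>-derivative of \<open>exp (- \<i> * s * t)\<close>.\<close>
  have d2: "(?v1 has_vector_derivative - \<i> * complex_of_real s * cis (- (s * t))) (at s)" for s
  proof -
    have "((\<lambda>s. \<i> - \<i> * cis (- (s * t)) + complex_of_real (s * t) * cis (- (s * t))) has_vector_derivative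
        t *\<^sub>R (- \<i> * complex_of_real (s * t) * cis (- (s * t)))) (at s)"
      using vector_diff_chain_at[OF lin vkern_deriv2] by (simp add: o_def)
    from has_vector_derivative_divide[OF this, of "complex_of_real t ^ 2"] show ?thesis
      by (rule has_vector_derivative_eq_rhs)
        (use t in \<open>simp add: scaleR_conv_of_real power2_eq_square\<close>)
  qed
  have "(LINT s|lborel. complex_of_real (deriv (deriv \<phi>) s) * vderiv s t)
      = - (LINT s|lborel. complex_of_real (deriv \<phi> s) * ?v1 s)"
    by (rule test_fn_by_parts[OF test_fn_deriv[OF \<phi>] d1]) (use t in \<open>auto intro!: continuous_intros\<close>)
  also have "(LINT s|lborel. complex_of_real (deriv \<phi> s) * ?v1 s)
      = - (LINT s|lborel. complex_of_real (\<phi> s) * (- \<i> * complex_of_real s * cis (- (s * t))))"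
    by (rule test_fn_by_parts[OF \<phi> d2]) (auto intro!: continuous_intros)
  also have "(LINT s|lborel. complex_of_real (\<phi> s) * (- \<i> * complex_of_real s * cis (- (s * t))))
      = (LINT s|lborel. - \<i> * (complex_of_real (s * \<phi> s) * cis (- (s * t))))"
    by (rule Bochner_Integration.integral_cong) (auto simp: algebra_simps)
  also have "\<dots> = fourier_deriv \<phi> t"
    unfolding fourier_deriv_def fourier_def by (rule integral_mult_right_zero)
  finally show ?thesis by simp
qed

text \<open>The two signs of the distributional derivatives cancel, so \<open>\<Omega>\<close> is
  tested against the second derivative of \<open>\<phi>\<close>. Fubini brings the
  \<open>s\<close>-integral inside, where integration by parts turns it into the derivative of the
  transform; the remaining sign is that of \<open>Omega_bc_deriv\<close>.\<close>

lemma Omega2_bc_deriv: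
  assumes F: "F \<in> Bc" and \<phi>: "test_fn \<phi>"
  shows "Omega2 (bc_deriv F) \<phi> = - (LINT t|lborel. F t * fourier_deriv \<phi> t)"
proof -
  let ?d = "deriv (deriv \<phi>)"
  have d: "test_fn ?d" by (intro test_fn_deriv \<phi>)
  note [measurable] = Bc_measurable[OF F] test_fn_measurable[OF d]
  define f where "f s t = complex_of_real (?d s) * (F t * vderiv s t)" for s t
  have int: "integrable (lborel \<Otimes>\<^sub>M lborel) (case_prod f)"
  proof (rule integrable_pair_dominated)
    show "case_prod f \<in> borel_measurable (lborel \<Otimes>\<^sub>M lborel)"
      unfolding f_def vderiv_def by measurable
    \<comment> \<open>The bound on \<open>vderiv\<close> grows in \<open>s\<close>, but the compact
      support of the test function absorbs this.\<close>
    have "integrable lborel (\<lambda>s. ?d s *\<^sub>R (supnorm F * (2 * (\<bar>s\<bar> ^ 3 + 2 * \<bar>s\<bar> + 4))))"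
      by (intro test_fn_integrable d continuous_intros)
    from integrable_abs[OF this]
    show "integrable lborel (\<lambda>s. \<bar>?d s\<bar> * \<bar>supnorm F * (2 * (\<bar>s\<bar> ^ 3 + 2 * \<bar>s\<bar> + 4))\<bar>)"
      by (simp add: abs_mult)
    show "integrable lborel (\<lambda>t::real. 1 / (1 + t\<^sup>2))" by (rule integrable_inverse_square_weight)
    fix s t
    have "cmod (F t * vderiv s t) \<le> supnorm F * (2 * (\<bar>s\<bar> ^ 3 + 2 * \<bar>s\<bar> + 4) / (1 + t\<^sup>2))"
      unfolding norm_mult
      by (intro mult_mono Bc_le_supnorm[OF F] vderiv_bound)
        (use order_trans[OF norm_ge_zero Bc_le_supnorm[OF F]] in auto)
    also have "\<dots> = (supnorm F * (2 * (\<bar>s\<bar> ^ 3 + 2 * \<bar>s\<bar> + 4))) * (1 / (1 + t\<^sup>2))" by simp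
    also have "\<dots> \<le> \<bar>supnorm F * (2 * (\<bar>s\<bar> ^ 3 + 2 * \<bar>s\<bar> + 4))\<bar> * (1 / (1 + t\<^sup>2))"
      by (intro mult_right_mono abs_ge_self) auto
    finally have "\<bar>?d s\<bar> * cmod (F t * vderiv s t) \<le> \<bar>?d s\<bar> * (\<bar>supnorm F * (2 * (\<bar>s\<bar> ^ 3 + 2 * \<bar>s\<bar> + 4))\<bar> * (1 / (1 + t\<^sup>2)))"
      by (intro mult_left_mono) auto
    then show "cmod (f s t) \<le> \<bar>?d s\<bar> * \<bar>supnorm F * (2 * (\<bar>s\<bar> ^ 3 + 2 * \<bar>s\<bar> + 4))\<bar> * (1 / (1 + t\<^sup>2))"
      unfolding f_def norm_mult[of "complex_of_real _"] by (simp add: mult.assoc)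
  qed
  have inner: "(LINT t|lborel. f s t) = - (complex_of_real (?d s) * Omega (bc_deriv F) s)" for s
    unfolding f_def Omega_bc_deriv[OF F] by simp
  \<comment> \<open>Fubini yields the integrability that identifies the gauge integral in
    \<open>dist_fun\<close> with a Lebesgue integral; continuity of \<open>\<Omega>\<close> is never
    established.\<close>
  have "integrable lborel (\<lambda>s. LINT t|lborel. f s t)"
    using lborel_pair.integrable_fst[OF int] by simp
  then have "integrable lborel (\<lambda>s. complex_of_real (?d s) * Omega (bc_deriv F) s)"
    unfolding inner by simp
  from integral_lborel[OF this]
  have "Omega2 (bc_deriv F) \<phi> = (LINT s|lborel. complex_of_real (?d s) * Omega (bc_deriv F) s)"
    by (simp add: Omega2_def distr_of_def dderiv_def dist_fun_def \<phi>)
  also have "\<dots> = - (LINT s|lborel. LINT t|lborel. f s t)"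
    unfolding inner by simp
  also have "(LINT s|lborel. LINT t|lborel. f s t) = (LINT t|lborel. LINT s|lborel. f s t)"
    by (rule lborel_pair.Fubini_integral[OF int, symmetric])
  also have "\<dots> = (LINT t|lborel. F t * fourier_deriv \<phi> t)"
  proof (rule integral_cong_AE)
    have "(LINT s|lborel. f s t) = F t * fourier_deriv \<phi> t" if "t \<noteq> 0" for t
    proof -
      have "(LINT s|lborel. f s t) = (LINT s|lborel. F t * (complex_of_real (?d s) * vderiv s t))"
        unfolding f_def by (rule Bochner_Integration.integral_cong) (auto simp: mult_ac)
      then show ?thesis by (simp only: integral_mult_right_zero LINT_deriv2_vderiv[OF \<phi> that])
    qed
    then show "AE t in lborel. (LINT s|lborel. f s t) = F t * fourier_deriv \<phi> t"
      using AE_lborel_singleton[of 0] by (auto elim!: eventually_mono)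
    show "(\<lambda>t. LINT s|lborel. f s t) \<in> borel_measurable lborel"
      using borel_measurable_integrable[OF lborel_pair.integrable_snd[OF int]] by simp
    have [measurable]: "fourier_deriv \<phi> \<in> borel_measurable borel"
      unfolding fourier_deriv_def
      by (intro borel_measurable_continuous_onI continuous_intros fourier_continuous test_fn_ident_mult \<phi>)
    show "(\<lambda>t. F t * fourier_deriv \<phi> t) \<in> borel_measurable lborel" by measurable
  qed
  finally show ?thesis .
qed

text \<open>Modulating the dilated \<open>\<psi>\<close> by \<open>cis (a * s)\<close> shifts its
  transform by \<open>a\<close>. Test functions are real, so the modulation is split into cosine and
  sine parts and recombined with \<open>\<i>\<close>. Of the two factors
  \<open>1 / \<epsilon>\<close>, one comes from the substitution \<open>s = u / \<epsilon>\<close>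
  and one from the weight \<open>s\<close>.\<close>

lemma fourier_deriv_modulated:
  fixes a t :: real
  assumes \<psi>: "test_fn \<psi>" and \<epsilon>: "\<epsilon> > 0"
  defines "c \<equiv> \<lambda>s. cos (a * s) * \<psi> (0 + \<epsilon> * s)" and "d \<equiv> \<lambda>s. sin (a * s) * \<psi> (0 + \<epsilon> * s)"
  shows "test_fn c" "test_fn d"
    "fourier_deriv c t + \<i> * fourier_deriv d t = fourier_deriv \<psi> ((t - a) / \<epsilon>) / complex_of_real (\<epsilon>\<^sup>2)"
proof -
  have \<psi>\<epsilon>: "test_fn (\<lambda>s. \<psi> (0 + \<epsilon> * s))" using \<epsilon> by (intro test_fn_affine[OF \<psi>]) auto
  show c: "test_fn c" unfolding c_def
    using smooth_fn_trig[of 1 a 0] by (intro test_fn_mult \<psi>\<epsilon>) simp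
  show d: "test_fn d" unfolding d_def
    using smooth_fn_trig[of 0 a 1] by (intro test_fn_mult \<psi>\<epsilon>) simp
  let ?\<xi> = "\<lambda>s. s * \<psi> s"
  have int: "integrable lborel (\<lambda>s. complex_of_real (s * \<eta> s) * cis (- (s * t)))" if "test_fn \<eta>" for \<eta>
    by (intro test_fn_times_integrable test_fn_ident_mult that continuous_intros)
  have "fourier (\<lambda>s. s * c s) t + \<i> * fourier (\<lambda>s. s * d s) t
      = (LINT s|lborel. complex_of_real (s * c s) * cis (- (s * t)) + \<i> * (complex_of_real (s * d s) * cis (- (s * t))))"
    unfolding fourier_def using int[OF c] int[OF d] by simp
  also have "\<dots> = (LINT s|lborel. complex_of_real (s * \<psi> (\<epsilon> * s)) * cis (- (s * (t - a))))"
  proof (rule Bochner_Integration.integral_cong)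
    fix s
    have "cis (a * s) = complex_of_real (cos (a * s)) + \<i> * complex_of_real (sin (a * s))"
      by (simp add: complex_eq_iff)
    then have "complex_of_real (s * c s) * cis (- (s * t)) + \<i> * (complex_of_real (s * d s) * cis (- (s * t)))
        = complex_of_real (s * \<psi> (\<epsilon> * s)) * (cis (a * s) * cis (- (s * t)))"
      by (simp add: c_def d_def algebra_simps)
    then show "complex_of_real (s * c s) * cis (- (s * t)) + \<i> * (complex_of_real (s * d s) * cis (- (s * t)))
        = complex_of_real (s * \<psi> (\<epsilon> * s)) * cis (- (s * (t - a)))"
      by (simp add: cis_mult algebra_simps)
  qed simp
  also have "\<dots> = (1 / \<epsilon>) *\<^sub>R (LINT u|lborel. complex_of_real ((1 / \<epsilon>) * u * \<psi> u) * cis (- ((1 / \<epsilon>) * u * (t - a))))"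
    using \<epsilon> by (subst lborel_integral_real_affine[of "1 / \<epsilon>" _ 0]) auto
  also have "(LINT u|lborel. complex_of_real ((1 / \<epsilon>) * u * \<psi> u) * cis (- ((1 / \<epsilon>) * u * (t - a))))
      = (LINT u|lborel. complex_of_real (1 / \<epsilon>) * (complex_of_real (u * \<psi> u) * cis (- (u * ((t - a) / \<epsilon>)))))"
    by (rule Bochner_Integration.integral_cong) (auto simp: algebra_simps)
  also have "\<dots> = complex_of_real (1 / \<epsilon>) * fourier ?\<xi> ((t - a) / \<epsilon>)"
    unfolding fourier_def by (rule integral_mult_right_zero)
  finally have "fourier (\<lambda>s. s * c s) t + \<i> * fourier (\<lambda>s. s * d s) t
      = fourier ?\<xi> ((t - a) / \<epsilon>) / complex_of_real (\<epsilon>\<^sup>2)"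
    by (simp add: scaleR_conv_of_real power2_eq_square)
  from arg_cong[OF this, of "\<lambda>z. - \<i> * z"]
  show "fourier_deriv c t + \<i> * fourier_deriv d t = fourier_deriv \<psi> ((t - a) / \<epsilon>) / complex_of_real (\<epsilon>\<^sup>2)"
    by (simp add: fourier_deriv_def algebra_simps)
qed

lemma Bc_fourier_deriv_integrable:
  assumes F: "F \<in> Bc" and \<phi>: "test_fn \<phi>"
  shows "integrable lborel (\<lambda>t. F t * fourier_deriv \<phi> t)"
proof -
  obtain C where "decaying_kernel (fourier \<phi>) (fourier_deriv \<phi>) C" using fourier_kernel[OF \<phi>] by blast
  then interpret decaying_kernel "fourier \<phi>" "fourier_deriv \<phi>" C .
  show ?thesis
    by (rule integrable_bounded_times_decay[OF Bc_measurable[OF F] measurable(2) Bc_le_supnorm[OF F] decay'])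
qed

text \<open>The kernel is a transform with nonzero integral. Each translate and dilate of its
  derivative is a combination of transform derivatives of two test functions, to which
  \<open>F\<close> is orthogonal by hypothesis.\<close>

lemma Bc_eq_zero_if_Omega2_zero:
  assumes F: "F \<in> Bc" and zero: "\<And>\<phi>. test_fn \<phi> \<Longrightarrow> Omega2 (bc_deriv F) \<phi> = 0"
  shows "F = (\<lambda>x. 0)"
proof -
  obtain \<psi> where \<psi>: "test_fn \<psi>" and mass: "(LINT t|lborel. fourier \<psi> t) \<noteq> 0"
    using fourier_mass_exists by blast
  obtain C where C: "decaying_kernel (fourier \<psi>) (fourier_deriv \<psi>) C" using fourier_kernel[OF \<psi>] by blast
  have z: "(LINT t|lborel. F t * fourier_deriv \<phi> t) = 0" if "test_fn \<phi>" for \<phi>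
    using zero[OF that] Omega2_bc_deriv[OF F that] by simp
  show ?thesis
  proof (rule decaying_kernel.eq_zero_if_correlations_zero[OF C F mass])
    fix a \<epsilon> :: real assume \<epsilon>: "\<epsilon> > 0"
    let ?c = "\<lambda>s. cos (a * s) * \<psi> (0 + \<epsilon> * s)" and ?d = "\<lambda>s. sin (a * s) * \<psi> (0 + \<epsilon> * s)"
    note mod = fourier_deriv_modulated[OF \<psi> \<epsilon>, of a]
    have "(LINT t|lborel. F t * fourier_deriv \<psi> ((t - a) / \<epsilon>))
        = (LINT t|lborel. complex_of_real (\<epsilon>\<^sup>2) * (F t * fourier_deriv ?c t + \<i> * (F t * fourier_deriv ?d t)))"
    proof (rule Bochner_Integration.integral_cong)
      fix t
      have "fourier_deriv \<psi> ((t - a) / \<epsilon>) = complex_of_real (\<epsilon>\<^sup>2) * (fourier_deriv ?c t + \<i> * fourier_deriv ?d t)"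
        using mod(3)[of t] \<epsilon> by (simp add: field_simps)
      then show "F t * fourier_deriv \<psi> ((t - a) / \<epsilon>)
          = complex_of_real (\<epsilon>\<^sup>2) * (F t * fourier_deriv ?c t + \<i> * (F t * fourier_deriv ?d t))"
        by (simp only: algebra_simps)
    qed simp
    also have "\<dots> = complex_of_real (\<epsilon>\<^sup>2) * ((LINT t|lborel. F t * fourier_deriv ?c t) + \<i> * (LINT t|lborel. F t * fourier_deriv ?d t))"
      using Bc_fourier_deriv_integrable[OF F mod(1)] Bc_fourier_deriv_integrable[OF F mod(2)] by simp
    also have "\<dots> = 0" unfolding z[OF mod(1)] z[OF mod(2)] by simp
    finally show "(LINT t|lborel. F t * fourier_deriv \<psi> ((t - a) / \<epsilon>)) = 0" .
  qed
qed

section \<open>Linearity, injectivity and norms of the two transforms\<close>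

lemma Omega_bc_deriv_add:
  assumes F: "F \<in> Bc" and G: "G \<in> Bc"
  shows "Omega (bc_deriv (\<lambda>x. F x + G x)) = (\<lambda>s. Omega (bc_deriv F) s + Omega (bc_deriv G) s)"
  unfolding Omega_bc_deriv[OF F] Omega_bc_deriv[OF G] Omega_bc_deriv[OF Bc_add[OF F G]]
  using Bc_vderiv_integrable[OF F] Bc_vderiv_integrable[OF G] by (simp add: distrib_right)

lemma Omega_bc_deriv_scale:
  assumes F: "F \<in> Bc"
  shows "Omega (bc_deriv (\<lambda>x. c * F x)) = (\<lambda>s. c * Omega (bc_deriv F) s)"
  unfolding Omega_bc_deriv[OF F] Omega_bc_deriv[OF Bc_scale[OF F]] by (simp add: mult.assoc)

lemma Omega2_not_test_fn: "\<not> test_fn \<phi> \<Longrightarrow> Omega2 f \<phi> = 0"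
  by (simp add: Omega2_def distr_of_def)

lemma Omega2_bc_deriv_add:
  assumes F: "F \<in> Bc" and G: "G \<in> Bc"
  shows "Omega2 (bc_deriv (\<lambda>x. F x + G x)) = (\<lambda>\<phi>. Omega2 (bc_deriv F) \<phi> + Omega2 (bc_deriv G) \<phi>)"
proof
  fix \<phi>
  show "Omega2 (bc_deriv (\<lambda>x. F x + G x)) \<phi> = Omega2 (bc_deriv F) \<phi> + Omega2 (bc_deriv G) \<phi>"
  proof (cases "test_fn \<phi>")
    case True
    with Bc_fourier_deriv_integrable[OF F True] Bc_fourier_deriv_integrable[OF G True] show ?thesis
      by (simp add: Omega2_bc_deriv F G Bc_add distrib_right)
  qed (simp add: Omega2_not_test_fn)
qed

lemma Omega2_bc_deriv_scale:
  assumes F: "F \<in> Bc"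
  shows "Omega2 (bc_deriv (\<lambda>x. c * F x)) = (\<lambda>\<phi>. c * Omega2 (bc_deriv F) \<phi>)"
proof
  fix \<phi>
  show "Omega2 (bc_deriv (\<lambda>x. c * F x)) \<phi> = c * Omega2 (bc_deriv F) \<phi>"
    by (cases "test_fn \<phi>") (simp_all add: Omega2_bc_deriv F Bc_scale mult.assoc Omega2_not_test_fn)
qed

lemma inj_on_Omega2: "inj_on (\<lambda>F. Omega2 (bc_deriv F)) Bc"
  by (rule inj_on_linear_Bc[OF Omega2_bc_deriv_add Omega2_bc_deriv_scale Bc_eq_zero_if_Omega2_zero]) auto

text \<open>\<open>Omega2 f\<close> depends on \<open>f\<close> only through \<open>Omega f\<close>,
  so injectivity passes from the former to the latter.\<close>

lemma inj_on_Omega: "inj_on (\<lambda>F. Omega (bc_deriv F)) Bc"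
  using inj_on_Omega2 by (auto simp: inj_on_def Omega2_def)

lemma alex_bc_deriv: "F \<in> Bc \<Longrightarrow> alex (bc_deriv F) = supnorm F"
  by (simp add: alex_def prim_bc_deriv)

text \<open>By injectivity the definite description in \<open>norm1\<close> selects
  \<open>bc_deriv F\<close>, whose Alexiewicz norm is the uniform norm of its primitive.\<close>

lemma norm1_Omega:
  assumes F: "F \<in> Bc" shows "norm1 (Omega (bc_deriv F)) = supnorm F"
proof -
  have "(THE f. f \<in> Ac \<and> Omega f = Omega (bc_deriv F)) = bc_deriv F"
    by (rule the_equality) (use F inj_on_Omega in \<open>auto simp: Ac_eq dest: inj_onD\<close>)
  then show ?thesis by (simp add: norm1_def alex_bc_deriv F)
qed

lemma norm2_Omega2:
  assumes F: "F \<in> Bc" shows "norm2 (Omega2 (bc_deriv F)) = supnorm F"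
proof -
  have "(THE f. f \<in> Ac \<and> Omega2 f = Omega2 (bc_deriv F)) = bc_deriv F"
    by (rule the_equality) (use F inj_on_Omega2 in \<open>auto simp: Ac_eq dest: inj_onD\<close>)
  then show ?thesis by (simp add: norm2_def alex_bc_deriv F)
qed

theorem mainTheorem2:
  shows "(banach_on Cc norm1 \<and> isometric_iso Ac alex Cc norm1)
    \<and> (banach_on Dc norm2 \<and> isometric_iso Ac alex Dc norm2)
    \<and> (banach_on Ac alex \<and> banach_on Bc supnorm \<and> banach_on Cc norm1 \<and> banach_on Dc norm2
       \<and> isometric_iso Ac alex Bc supnorm \<and> isometric_iso Ac alex Cc norm1
       \<and> isometric_iso Ac alex Dc norm2 \<and> isometric_iso Bc supnorm Cc norm1
       \<and> isometric_iso Bc supnorm Dc norm2 \<and> isometric_iso Cc norm1 Dc norm2)"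
proof -
  have Cc: "Cc = (\<lambda>F. Omega (bc_deriv F)) ` Bc" and Dc: "Dc = (\<lambda>F. Omega2 (bc_deriv F)) ` Bc"
    by (auto simp: Cc_def Dc_def Ac_eq)
  have A: "banach_on Ac alex" "isometric_iso Bc supnorm Ac alex"
    unfolding Ac_eq
    by (rule banach_on_isometric_image[where \<Phi> = "bc_deriv" and N = supnorm], rule banach_on_Bc,
        rule inj_on_bc_deriv, erule (1) bc_deriv_add, erule bc_deriv_scale, erule alex_bc_deriv)+
  have C: "banach_on Cc norm1" "isometric_iso Bc supnorm Cc norm1"
    unfolding Cc
    by (rule banach_on_isometric_image[where \<Phi> = "\<lambda>F. Omega (bc_deriv F)" and N = supnorm], rule banach_on_Bc,
        rule inj_on_Omega, erule (1) Omega_bc_deriv_add, erule Omega_bc_deriv_scale, erule norm1_Omega)+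
  have D: "banach_on Dc norm2" "isometric_iso Bc supnorm Dc norm2"
    unfolding Dc
    by (rule banach_on_isometric_image[where \<Phi> = "\<lambda>F. Omega2 (bc_deriv F)" and N = supnorm], rule banach_on_Bc,
        rule inj_on_Omega2, erule (1) Omega2_bc_deriv_add, erule Omega2_bc_deriv_scale, erule norm2_Omega2)+
  \<comment> \<open>All isometries found so far start at \<open>Bc\<close>; inverting them lets the
    remaining pairs be connected through \<open>Bc\<close>.\<close>
  have AB: "isometric_iso Ac alex Bc supnorm" by (rule isometric_iso_sym[OF cspace_Bc A(2)])
  have CB: "isometric_iso Cc norm1 Bc supnorm" by (rule isometric_iso_sym[OF cspace_Bc C(2)])
  show ?thesis
    using A C D AB banach_on_Bc isometric_iso_trans[OF AB C(2)] isometric_iso_trans[OF AB D(2)]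
      isometric_iso_trans[OF CB D(2)] by blast
qed

end
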